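(* Let $\mathcal{C}$ and $\mathcal{D}$ be flCwFs and let $F$ be a weak flCwF morphism from $\mathcal{C}$ to $\mathcal{D}$. Then $F$ preserves the fl-structure up to type isomorphism: for every context $\Gamma$ of $\mathcal{C}$, all types $A : \mathsf{Ty}_{\mathcal{C}}\,\Gamma$, $B : \mathsf{Ty}_{\mathcal{C}}\,(\Gamma\triangleright A)$, every context $\Delta$ of $\mathcal{C}$ and all terms $t,u : \mathsf{Tm}_{\mathcal{C}}\,\Gamma\,A$, there are type isomorphisms in the type category of $F\Gamma$ in $\mathcal{D}$: \[ F_{\Sigma} : F(\Sigma\,A\,B) \simeq \Sigma\,(FA)\,((FB)[F_{\triangleright}^{-1}]),\qquad F_{\mathsf{K}} : F(\mathsf{K}\,\Delta)\simeq \mathsf{K}\,(F\Delta),\qquad F_{\mathsf{Id}} : F(\mathsf{Id}\,A\,t\,u)\simeq \mathsf{Id}\,(FA)\,(Ft)\,(Fu). \] These isomorphisms are natural with respect to substitution: for a substitution $\sigma$ of $\mathcal{C}$, reindexing (via the functorial action of $F\sigma$ on type categories) the isomorphism $F_\Sigma$ (resp. $F_{\mathsf{K}}$, $F_{\mathsf{Id}}$) for given data yields the isomorphism $F_\Sigma$ (resp. $F_{\mathsf{K}}$, $F_{\mathsf{Id}}$) for the correspondingly substituted data. Moreover, $F$ preserves all term and substitution formers of the fl-structure (modulo these isomorphisms); for example, for $t : \mathsf{Tm}_{\mathcal{C}}\,\Gamma\,(\Sigma\,A\,B)$ one has $F(\mathsf{proj}_1\,t) = \mathsf{proj}_1\,(F_{\Sigma}[\mathsf{id},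 Ft])$.
   Context: The metatheory is extensional type theory (equality reflection, uniqueness of identity proofs) with a hierarchy of universes $\mathsf{Set}_i$. A category with families (CwF) consists of a category of contexts $\mathsf{Con}$ and substitutions $\mathsf{Sub}\,\Gamma\,\Delta$ (identity $\mathsf{id}$, composition $\circ$), types $\mathsf{Ty}\,\Gamma$ and terms $\mathsf{Tm}\,\Gamma\,A$ with substitution operations $A[\sigma]$, $t[\sigma]$ (functorial), a terminal empty context $\bullet$ with unique maps $\epsilon$, and context extension $\Gamma\triangleright A$ with $\mathsf{p} : \mathsf{Sub}\,(\Gamma\triangleright A)\,\Gamma$, $\mathsf{q} : \mathsf{Tm}\,(\Gamma\triangleright A)\,(A[\mathsf{p}])$ and pairing $(\sigma, t) : \mathsf{Sub}\,\Gamma\,(\Delta\triangleright A)$ for $t : \mathsf{Tm}\,\Gamma\,(A[\sigma])$, satisfying the usual $\beta\eta$ laws. An flCwF is a CwF equipped with: $\Sigma$-types $\Sigma\,A\,B : \mathsf{Ty}\,\Gamma$ for $A:\mathsf{Ty}\,\Gamma$, $B : \mathsf{Ty}\,(\Gamma\triangleright A)$, with pairing and projections $\mathsf{proj}_1,\mathsf{proj}_2$ (with $\beta\eta$, stable under substitution); extensional identity types $\mathsf{Id}\,A\,t\,u : \mathsf{Ty}\,\Gamma$ with $\mathsf{refl}$, equality reflection and UIP; and constant families: for every context $\Delta$ and every $\Gamma$, a type $\mathsf{K}\,\Delta : \mathsf{Ty}\,\Gamma$ stable under substitution, with a natural bijection $\mathsf{lam}^{\mathsf{K}} : \mathsf{Sub}\,\Gamma\,\Delta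 \to \mathsf{Tm}\,\Gamma\,(\mathsf{K}\,\Delta)$ with inverse $\mathsf{app}^{\mathsf{K}}$. This extra structure ($\Sigma$, $\mathsf{Id}$, $\mathsf{K}$) is called the fl-structure. Type categories: for a context $\Gamma$, the type category has objects $A : \mathsf{Ty}\,\Gamma$ and morphisms from $A$ to $B$ the terms $t : \mathsf{Tm}\,(\Gamma\triangleright A)\,(B[\mathsf{p}])$, identity $\mathsf{q}$, composition $t\circ u := t[\mathsf{p}, u]$. For $\sigma : \mathsf{Sub}\,\Gamma\,\Delta$ there is a reindexing functor from the type category of $\Delta$ to that of $\Gamma$: $A\mapsto A[\sigma]$, $t\mapsto t[\sigma\circ\mathsf{p},\mathsf{q}]$. A type isomorphism $A\simeq B$ is an isomorphism in a type category; a context isomorphism is an invertible substitution. A weak flCwF morphism $F$ from $\mathcal{C}$ to $\mathcal{D}$ is a functor between the underlying categories of contexts together with maps $F : \mathsf{Ty}_{\mathcal{C}}\,\Gamma\to\mathsf{Ty}_{\mathcal{D}}\,(F\Gamma)$ and $F : \mathsf{Tm}_{\mathcal{C}}\,\Gamma\,A\to\mathsf{Tm}_{\mathcal{D}}\,(F\Gamma)\,(FA)$ such that $F(A[\sigma]) = (FA)[F\sigma]$, $F(t[\sigma]) = (Ft)[F\sigma]$, the unique map $\epsilon : \mathsf{Sub}\,(F\bullet)\,\bullet$ has a retraction, and each $(F\mathsf{p}, F\mathsf{q}) : \mathsf{Sub}\,(F(\Gamma\triangleright A))\,(F\Gamma\triangleright FA)$ has an inverse. These isomorphisms are denoted $F_\bullet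 : F\bullet\simeq\bullet$ and $F_{\triangleright} : F(\Gamma\triangleright A)\simeq F\Gamma\triangleright FA$, with inverse $F_{\triangleright}^{-1}$. *)

theory Defs
  imports Main
begin

text \<open>
  Categories with families are rendered as generalized algebraic structures: every sort is a family
  of sets over carriers, and every operation receives all of its implicit index arguments.
  The families of sets are therefore not required to be disjoint, and operations are constrained
  only on the carriers.  Equality of types is equality of elements, so that terms need no transport
  along equations between types, as in extensional type theory.

  Argument conventions: for \<open>\<delta> \<in> Sub \<Gamma> \<Delta>\<close> and \<open>\<sigma> \<in> Sub \<Delta> \<Theta>\<close>, the composite \<open>\<sigma> \<circ> \<delta>\<close> is
  \<open>comp_sub \<Gamma> \<Delta> \<Theta> \<sigma> \<delta>\<close>.  For \<open>\<sigma> \<in> Sub \<Gamma> \<Delta>\<close>, the type \<open>A[\<sigma>]\<close> is \<open>ty_sub \<Gamma> \<Delta> A \<sigma>\<close>, the term \<open>t[\<sigma>]\<close>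
  is \<open>tm_sub \<Gamma> \<Delta> A t \<sigma>\<close>, and \<open>(\<sigma>, t)\<close> is \<open>pair_sub \<Gamma> \<Delta> A \<sigma> t\<close>.
\<close>

record ('con, 'sub, 'ty, 'tm) cwf =
  Con :: "'con set"
  Sub :: "'con \<Rightarrow> 'con \<Rightarrow> 'sub set"
  Ty :: "'con \<Rightarrow> 'ty set"
  Tm :: "'con \<Rightarrow> 'ty \<Rightarrow> 'tm set"
  id_sub :: "'con \<Rightarrow> 'sub"
  comp_sub :: "'con \<Rightarrow> 'con \<Rightarrow> 'con \<Rightarrow> 'sub \<Rightarrow> 'sub \<Rightarrow> 'sub"
  ty_sub :: "'con \<Rightarrow> 'con \<Rightarrow> 'ty \<Rightarrow> 'sub \<Rightarrow> 'ty"
  tm_sub :: "'con \<Rightarrow> 'con \<Rightarrow> 'ty \<Rightarrow> 'tm \<Rightarrow> 'sub \<Rightarrow> 'tm"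
  emp :: "'con"
  eps :: "'con \<Rightarrow> 'sub"
  ext :: "'con \<Rightarrow> 'ty \<Rightarrow> 'con"
  p_sub :: "'con \<Rightarrow> 'ty \<Rightarrow> 'sub"
  q_tm :: "'con \<Rightarrow> 'ty \<Rightarrow> 'tm"
  pair_sub :: "'con \<Rightarrow> 'con \<Rightarrow> 'ty \<Rightarrow> 'sub \<Rightarrow> 'tm \<Rightarrow> 'sub"

locale cwf =
  fixes C :: "('con, 'sub, 'ty, 'tm, 'z) cwf_scheme"
  assumes id_sub_closed: "\<Gamma> \<in> Con C \<Longrightarrow> id_sub C \<Gamma> \<in> Sub C \<Gamma> \<Gamma>"
    and comp_closed:
      "\<lbrakk>\<Gamma> \<in> Con C; \<Delta> \<in> Con C; \<Theta> \<in> Con C; \<delta> \<in> Sub C \<Gamma> \<Delta>; \<sigma> \<in> Sub C \<Delta> \<Theta>\<rbrakk>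
        \<Longrightarrow> comp_sub C \<Gamma> \<Delta> \<Theta> \<sigma> \<delta> \<in> Sub C \<Gamma> \<Theta>"
    and comp_id_left:
      "\<lbrakk>\<Gamma> \<in> Con C; \<Delta> \<in> Con C; \<sigma> \<in> Sub C \<Gamma> \<Delta>\<rbrakk> \<Longrightarrow> comp_sub C \<Gamma> \<Delta> \<Delta> (id_sub C \<Delta>) \<sigma> = \<sigma>"
    and comp_id_right:
      "\<lbrakk>\<Gamma> \<in> Con C; \<Delta> \<in> Con C; \<sigma> \<in> Sub C \<Gamma> \<Delta>\<rbrakk> \<Longrightarrow> comp_sub C \<Gamma> \<Gamma> \<Delta> \<sigma> (id_sub C \<Gamma>) = \<sigma>"
    and comp_assoc:
      "\<lbrakk>\<Gamma> \<in> Con C; \<Delta> \<in> Con C; \<Theta> \<in> Con C; \<Xi> \<in> Con C;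
        \<nu> \<in> Sub C \<Gamma> \<Delta>; \<delta> \<in> Sub C \<Delta> \<Theta>; \<sigma> \<in> Sub C \<Theta> \<Xi>\<rbrakk>
        \<Longrightarrow> comp_sub C \<Gamma> \<Delta> \<Xi> (comp_sub C \<Delta> \<Theta> \<Xi> \<sigma> \<delta>) \<nu>
          = comp_sub C \<Gamma> \<Theta> \<Xi> \<sigma> (comp_sub C \<Gamma> \<Delta> \<Theta> \<delta> \<nu>)"
    and ty_sub_closed:
      "\<lbrakk>\<Gamma> \<in> Con C; \<Delta> \<in> Con C; A \<in> Ty C \<Delta>; \<sigma> \<in> Sub C \<Gamma> \<Delta>\<rbrakk> \<Longrightarrow> ty_sub C \<Gamma> \<Delta> A \<sigma> \<in> Ty C \<Gamma>"
    and ty_sub_id: "\<lbrakk>\<Gamma> \<in> Con C; A \<in> Ty C \<Gamma>\<rbrakk> \<Longrightarrow> ty_sub C \<Gamma> \<Gamma> A (id_sub C \<Gamma>) = A"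
    and ty_sub_comp:
      "\<lbrakk>\<Gamma> \<in> Con C; \<Delta> \<in> Con C; \<Theta> \<in> Con C; A \<in> Ty C \<Theta>; \<delta> \<in> Sub C \<Gamma> \<Delta>; \<sigma> \<in> Sub C \<Delta> \<Theta>\<rbrakk>
        \<Longrightarrow> ty_sub C \<Gamma> \<Theta> A (comp_sub C \<Gamma> \<Delta> \<Theta> \<sigma> \<delta>) = ty_sub C \<Gamma> \<Delta> (ty_sub C \<Delta> \<Theta> A \<sigma>) \<delta>"
    and tm_sub_closed:
      "\<lbrakk>\<Gamma> \<in> Con C; \<Delta> \<in> Con C; A \<in> Ty C \<Delta>; t \<in> Tm C \<Delta> A; \<sigma> \<in> Sub C \<Gamma> \<Delta>\<rbrakk>
        \<Longrightarrow> tm_sub C \<Gamma> \<Delta> A t \<sigma> \<in> Tm C \<Gamma> (ty_sub C \<Gamma> \<Delta> A \<sigma>)"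
    and tm_sub_id:
      "\<lbrakk>\<Gamma> \<in> Con C; A \<in> Ty C \<Gamma>; t \<in> Tm C \<Gamma> A\<rbrakk> \<Longrightarrow> tm_sub C \<Gamma> \<Gamma> A t (id_sub C \<Gamma>) = t"
    and tm_sub_comp:
      "\<lbrakk>\<Gamma> \<in> Con C; \<Delta> \<in> Con C; \<Theta> \<in> Con C; A \<in> Ty C \<Theta>; t \<in> Tm C \<Theta> A;
        \<delta> \<in> Sub C \<Gamma> \<Delta>; \<sigma> \<in> Sub C \<Delta> \<Theta>\<rbrakk>
        \<Longrightarrow> tm_sub C \<Gamma> \<Theta> A t (comp_sub C \<Gamma> \<Delta> \<Theta> \<sigma> \<delta>)
          = tm_sub C \<Gamma> \<Delta> (ty_sub C \<Delta> \<Theta> A \<sigma>) (tm_sub C \<Delta> \<Theta> A t \<sigma>) \<delta>"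
    and emp_closed: "emp C \<in> Con C"
    and eps_closed: "\<Gamma> \<in> Con C \<Longrightarrow> eps C \<Gamma> \<in> Sub C \<Gamma> (emp C)"
    and eps_unique: "\<lbrakk>\<Gamma> \<in> Con C; \<sigma> \<in> Sub C \<Gamma> (emp C)\<rbrakk> \<Longrightarrow> \<sigma> = eps C \<Gamma>"
    and ext_closed: "\<lbrakk>\<Gamma> \<in> Con C; A \<in> Ty C \<Gamma>\<rbrakk> \<Longrightarrow> ext C \<Gamma> A \<in> Con C"
    and p_sub_closed: "\<lbrakk>\<Gamma> \<in> Con C; A \<in> Ty C \<Gamma>\<rbrakk> \<Longrightarrow> p_sub C \<Gamma> A \<in> Sub C (ext C \<Gamma> A) \<Gamma>"
    and q_tm_closed:
      "\<lbrakk>\<Gamma> \<in> Con C; A \<in> Ty C \<Gamma>\<rbrakk>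
        \<Longrightarrow> q_tm C \<Gamma> A \<in> Tm C (ext C \<Gamma> A) (ty_sub C (ext C \<Gamma> A) \<Gamma> A (p_sub C \<Gamma> A))"
    and pair_sub_closed:
      "\<lbrakk>\<Gamma> \<in> Con C; \<Delta> \<in> Con C; A \<in> Ty C \<Delta>; \<sigma> \<in> Sub C \<Gamma> \<Delta>; t \<in> Tm C \<Gamma> (ty_sub C \<Gamma> \<Delta> A \<sigma>)\<rbrakk>
        \<Longrightarrow> pair_sub C \<Gamma> \<Delta> A \<sigma> t \<in> Sub C \<Gamma> (ext C \<Delta> A)"
    and p_sub_beta:
      "\<lbrakk>\<Gamma> \<in> Con C; \<Delta> \<in> Con C; A \<in> Ty C \<Delta>; \<sigma> \<in> Sub C \<Gamma> \<Delta>; t \<in> Tm C \<Gamma> (ty_sub C \<Gamma> \<Delta> A \<sigma>)\<rbrakk>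
        \<Longrightarrow> comp_sub C \<Gamma> (ext C \<Delta> A) \<Delta> (p_sub C \<Delta> A) (pair_sub C \<Gamma> \<Delta> A \<sigma> t) = \<sigma>"
    and q_tm_beta:
      "\<lbrakk>\<Gamma> \<in> Con C; \<Delta> \<in> Con C; A \<in> Ty C \<Delta>; \<sigma> \<in> Sub C \<Gamma> \<Delta>; t \<in> Tm C \<Gamma> (ty_sub C \<Gamma> \<Delta> A \<sigma>)\<rbrakk>
        \<Longrightarrow> tm_sub C \<Gamma> (ext C \<Delta> A) (ty_sub C (ext C \<Delta> A) \<Delta> A (p_sub C \<Delta> A)) (q_tm C \<Delta> A)
              (pair_sub C \<Gamma> \<Delta> A \<sigma> t) = t"
    and pair_sub_eta:
      "\<lbrakk>\<Gamma> \<in> Con C; \<Delta> \<in> Con C; A \<in> Ty C \<Delta>; \<sigma> \<in> Sub C \<Gamma> (ext C \<Delta> A)\<rbrakk>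
        \<Longrightarrow> pair_sub C \<Gamma> \<Delta> A (comp_sub C \<Gamma> (ext C \<Delta> A) \<Delta> (p_sub C \<Delta> A) \<sigma>)
              (tm_sub C \<Gamma> (ext C \<Delta> A) (ty_sub C (ext C \<Delta> A) \<Delta> A (p_sub C \<Delta> A)) (q_tm C \<Delta> A) \<sigma>)
          = \<sigma>"

text \<open>The section \<open>(id, t)\<close> for \<open>t \<in> Tm \<Gamma> A\<close>, using \<open>A[id] = A\<close>.\<close>

definition sect :: "('con, 'sub, 'ty, 'tm, 'z) cwf_scheme \<Rightarrow> 'con \<Rightarrow> 'ty \<Rightarrow> 'tm \<Rightarrow> 'sub" where
  "sect C \<Gamma> A t = pair_sub C \<Gamma> \<Gamma> A (id_sub C \<Gamma>) t"

text \<open>The lifting \<open>(\<sigma> \<circ> p, q) \<in> Sub (\<Gamma> \<triangleright> A[\<sigma>]) (\<Delta> \<triangleright> A)\<close> of \<open>\<sigma> \<in> Sub \<Gamma> \<Delta>\<close>.\<close>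

definition lift_sub ::
  "('con, 'sub, 'ty, 'tm, 'z) cwf_scheme \<Rightarrow> 'con \<Rightarrow> 'con \<Rightarrow> 'ty \<Rightarrow> 'sub \<Rightarrow> 'sub" where
  "lift_sub C \<Gamma> \<Delta> A \<sigma> =
    (let A' = ty_sub C \<Gamma> \<Delta> A \<sigma>; \<Gamma>' = ext C \<Gamma> A'
     in pair_sub C \<Gamma>' \<Delta> A (comp_sub C \<Gamma>' \<Gamma> \<Delta> \<sigma> (p_sub C \<Gamma> A')) (q_tm C \<Gamma> A'))"

text \<open>
  The fl-structure.  \<open>Idt \<Gamma> A t u\<close> is the identity type, and \<open>K \<Gamma> \<Delta>\<close> is the constant family \<open>K \<Delta>\<close>
  as a type in \<open>\<Gamma>\<close>.
\<close>

record ('con, 'sub, 'ty, 'tm) flcwf = "('con, 'sub, 'ty, 'tm) cwf" +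
  Sig :: "'con \<Rightarrow> 'ty \<Rightarrow> 'ty \<Rightarrow> 'ty"
  spair :: "'con \<Rightarrow> 'ty \<Rightarrow> 'ty \<Rightarrow> 'tm \<Rightarrow> 'tm \<Rightarrow> 'tm"
  proj1 :: "'con \<Rightarrow> 'ty \<Rightarrow> 'ty \<Rightarrow> 'tm \<Rightarrow> 'tm"
  proj2 :: "'con \<Rightarrow> 'ty \<Rightarrow> 'ty \<Rightarrow> 'tm \<Rightarrow> 'tm"
  Idt :: "'con \<Rightarrow> 'ty \<Rightarrow> 'tm \<Rightarrow> 'tm \<Rightarrow> 'ty"
  rfl :: "'con \<Rightarrow> 'ty \<Rightarrow> 'tm \<Rightarrow> 'tm"
  K :: "'con \<Rightarrow> 'con \<Rightarrow> 'ty"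
  lamK :: "'con \<Rightarrow> 'con \<Rightarrow> 'sub \<Rightarrow> 'tm"
  appK :: "'con \<Rightarrow> 'con \<Rightarrow> 'tm \<Rightarrow> 'sub"

text \<open>
  Stability under substitution is postulated for the type formers, for pairing and for \<open>lamK\<close>.
  For the projections and \<open>appK\<close> it follows from the beta and eta laws, and for \<open>rfl\<close> from
  uniqueness of identity proofs.
\<close>

locale flcwf = cwf C for C :: "('con, 'sub, 'ty, 'tm, 'z) flcwf_scheme" +
  assumes Sig_closed:
      "\<lbrakk>\<Gamma> \<in> Con C; A \<in> Ty C \<Gamma>; B \<in> Ty C (ext C \<Gamma> A)\<rbrakk> \<Longrightarrow> Sig C \<Gamma> A B \<in> Ty C \<Gamma>"
    and Sig_sub:
      "\<lbrakk>\<Gamma> \<in> Con C; \<Delta> \<in> Con C; A \<in> Ty C \<Delta>; B \<in> Ty C (ext C \<Delta> A); \<sigma> \<in> Sub C \<Gamma> \<Delta>\<rbrakk>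
        \<Longrightarrow> ty_sub C \<Gamma> \<Delta> (Sig C \<Delta> A B) \<sigma>
          = Sig C \<Gamma> (ty_sub C \<Gamma> \<Delta> A \<sigma>)
              (ty_sub C (ext C \<Gamma> (ty_sub C \<Gamma> \<Delta> A \<sigma>)) (ext C \<Delta> A) B (lift_sub C \<Gamma> \<Delta> A \<sigma>))"
    and spair_closed:
      "\<lbrakk>\<Gamma> \<in> Con C; A \<in> Ty C \<Gamma>; B \<in> Ty C (ext C \<Gamma> A); t \<in> Tm C \<Gamma> A;
        u \<in> Tm C \<Gamma> (ty_sub C \<Gamma> (ext C \<Gamma> A) B (sect C \<Gamma> A t))\<rbrakk>
        \<Longrightarrow> spair C \<Gamma> A B t u \<in> Tm C \<Gamma> (Sig C \<Gamma> A B)"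
    and proj1_closed:
      "\<lbrakk>\<Gamma> \<in> Con C; A \<in> Ty C \<Gamma>; B \<in> Ty C (ext C \<Gamma> A); t \<in> Tm C \<Gamma> (Sig C \<Gamma> A B)\<rbrakk>
        \<Longrightarrow> proj1 C \<Gamma> A B t \<in> Tm C \<Gamma> A"
    and proj2_closed:
      "\<lbrakk>\<Gamma> \<in> Con C; A \<in> Ty C \<Gamma>; B \<in> Ty C (ext C \<Gamma> A); t \<in> Tm C \<Gamma> (Sig C \<Gamma> A B)\<rbrakk>
        \<Longrightarrow> proj2 C \<Gamma> A B t
            \<in> Tm C \<Gamma> (ty_sub C \<Gamma> (ext C \<Gamma> A) B (sect C \<Gamma> A (proj1 C \<Gamma> A B t)))"
    and proj1_beta:
      "\<lbrakk>\<Gamma> \<in> Con C; A \<in> Ty C \<Gamma>; B \<in> Ty C (ext C \<Gamma> A); t \<in> Tm C \<Gamma> A;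
        u \<in> Tm C \<Gamma> (ty_sub C \<Gamma> (ext C \<Gamma> A) B (sect C \<Gamma> A t))\<rbrakk>
        \<Longrightarrow> proj1 C \<Gamma> A B (spair C \<Gamma> A B t u) = t"
    and proj2_beta:
      "\<lbrakk>\<Gamma> \<in> Con C; A \<in> Ty C \<Gamma>; B \<in> Ty C (ext C \<Gamma> A); t \<in> Tm C \<Gamma> A;
        u \<in> Tm C \<Gamma> (ty_sub C \<Gamma> (ext C \<Gamma> A) B (sect C \<Gamma> A t))\<rbrakk>
        \<Longrightarrow> proj2 C \<Gamma> A B (spair C \<Gamma> A B t u) = u"
    and spair_eta:
      "\<lbrakk>\<Gamma> \<in> Con C; A \<in> Ty C \<Gamma>; B \<in> Ty C (ext C \<Gamma> A); t \<in> Tm C \<Gamma> (Sig C \<Gamma> A B)\<rbrakk>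
        \<Longrightarrow> spair C \<Gamma> A B (proj1 C \<Gamma> A B t) (proj2 C \<Gamma> A B t) = t"
    and spair_sub:
      "\<lbrakk>\<Gamma> \<in> Con C; \<Delta> \<in> Con C; A \<in> Ty C \<Delta>; B \<in> Ty C (ext C \<Delta> A); \<sigma> \<in> Sub C \<Gamma> \<Delta>;
        t \<in> Tm C \<Delta> A; u \<in> Tm C \<Delta> (ty_sub C \<Delta> (ext C \<Delta> A) B (sect C \<Delta> A t))\<rbrakk>
        \<Longrightarrow> tm_sub C \<Gamma> \<Delta> (Sig C \<Delta> A B) (spair C \<Delta> A B t u) \<sigma>
          = spair C \<Gamma> (ty_sub C \<Gamma> \<Delta> A \<sigma>)
              (ty_sub C (ext C \<Gamma> (ty_sub C \<Gamma> \<Delta> A \<sigma>)) (ext C \<Delta> A) B (lift_sub C \<Gamma> \<Delta> A \<sigma>))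
              (tm_sub C \<Gamma> \<Delta> A t \<sigma>)
              (tm_sub C \<Gamma> \<Delta> (ty_sub C \<Delta> (ext C \<Delta> A) B (sect C \<Delta> A t)) u \<sigma>)"
    and Idt_closed:
      "\<lbrakk>\<Gamma> \<in> Con C; A \<in> Ty C \<Gamma>; t \<in> Tm C \<Gamma> A; u \<in> Tm C \<Gamma> A\<rbrakk> \<Longrightarrow> Idt C \<Gamma> A t u \<in> Ty C \<Gamma>"
    and Idt_sub:
      "\<lbrakk>\<Gamma> \<in> Con C; \<Delta> \<in> Con C; A \<in> Ty C \<Delta>; t \<in> Tm C \<Delta> A; u \<in> Tm C \<Delta> A; \<sigma> \<in> Sub C \<Gamma> \<Delta>\<rbrakk>
        \<Longrightarrow> ty_sub C \<Gamma> \<Delta> (Idt C \<Delta> A t u) \<sigma>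
          = Idt C \<Gamma> (ty_sub C \<Gamma> \<Delta> A \<sigma>) (tm_sub C \<Gamma> \<Delta> A t \<sigma>) (tm_sub C \<Gamma> \<Delta> A u \<sigma>)"
    and rfl_closed:
      "\<lbrakk>\<Gamma> \<in> Con C; A \<in> Ty C \<Gamma>; t \<in> Tm C \<Gamma> A\<rbrakk> \<Longrightarrow> rfl C \<Gamma> A t \<in> Tm C \<Gamma> (Idt C \<Gamma> A t t)"
    and reflection:
      "\<lbrakk>\<Gamma> \<in> Con C; A \<in> Ty C \<Gamma>; t \<in> Tm C \<Gamma> A; u \<in> Tm C \<Gamma> A; e \<in> Tm C \<Gamma> (Idt C \<Gamma> A t u)\<rbrakk>
        \<Longrightarrow> t = u"
    and UIP:
      "\<lbrakk>\<Gamma> \<in> Con C; A \<in> Ty C \<Gamma>; t \<in> Tm C \<Gamma> A; u \<in> Tm C \<Gamma> A;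
        e \<in> Tm C \<Gamma> (Idt C \<Gamma> A t u); e' \<in> Tm C \<Gamma> (Idt C \<Gamma> A t u)\<rbrakk>
        \<Longrightarrow> e = e'"
    and K_closed: "\<lbrakk>\<Gamma> \<in> Con C; \<Delta> \<in> Con C\<rbrakk> \<Longrightarrow> K C \<Gamma> \<Delta> \<in> Ty C \<Gamma>"
    and K_sub:
      "\<lbrakk>\<Gamma> \<in> Con C; \<Delta> \<in> Con C; \<Theta> \<in> Con C; \<sigma> \<in> Sub C \<Gamma> \<Delta>\<rbrakk>
        \<Longrightarrow> ty_sub C \<Gamma> \<Delta> (K C \<Delta> \<Theta>) \<sigma> = K C \<Gamma> \<Theta>"
    and lamK_closed:
      "\<lbrakk>\<Gamma> \<in> Con C; \<Delta> \<in> Con C; \<sigma> \<in> Sub C \<Gamma> \<Delta>\<rbrakk> \<Longrightarrow> lamK C \<Gamma> \<Delta> \<sigma> \<in> Tm C \<Gamma> (K C \<Gamma> \<Delta>)"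
    and appK_closed:
      "\<lbrakk>\<Gamma> \<in> Con C; \<Delta> \<in> Con C; t \<in> Tm C \<Gamma> (K C \<Gamma> \<Delta>)\<rbrakk> \<Longrightarrow> appK C \<Gamma> \<Delta> t \<in> Sub C \<Gamma> \<Delta>"
    and appK_lamK:
      "\<lbrakk>\<Gamma> \<in> Con C; \<Delta> \<in> Con C; \<sigma> \<in> Sub C \<Gamma> \<Delta>\<rbrakk> \<Longrightarrow> appK C \<Gamma> \<Delta> (lamK C \<Gamma> \<Delta> \<sigma>) = \<sigma>"
    and lamK_appK:
      "\<lbrakk>\<Gamma> \<in> Con C; \<Delta> \<in> Con C; t \<in> Tm C \<Gamma> (K C \<Gamma> \<Delta>)\<rbrakk> \<Longrightarrow> lamK C \<Gamma> \<Delta> (appK C \<Gamma> \<Delta> t) = t"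
    and lamK_sub:
      "\<lbrakk>\<Gamma> \<in> Con C; \<Delta> \<in> Con C; \<Theta> \<in> Con C; \<delta> \<in> Sub C \<Gamma> \<Delta>; \<sigma> \<in> Sub C \<Delta> \<Theta>\<rbrakk>
        \<Longrightarrow> tm_sub C \<Gamma> \<Delta> (K C \<Delta> \<Theta>) (lamK C \<Delta> \<Theta> \<sigma>) \<delta> = lamK C \<Gamma> \<Theta> (comp_sub C \<Gamma> \<Delta> \<Theta> \<sigma> \<delta>)"

text \<open>
  The type category of \<open>\<Gamma>\<close>: morphisms \<open>A \<rightarrow> B\<close> are terms of type \<open>B[p]\<close> in \<open>\<Gamma> \<triangleright> A\<close>, the identity is
  \<open>q\<close>, and \<open>t \<circ> u = t[p, u]\<close>.
\<close>

definition ty_hom :: "('con, 'sub, 'ty, 'tm, 'z) cwf_scheme \<Rightarrow> 'con \<Rightarrow> 'ty \<Rightarrow> 'ty \<Rightarrow> 'tm set" where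
  "ty_hom C \<Gamma> A B = Tm C (ext C \<Gamma> A) (ty_sub C (ext C \<Gamma> A) \<Gamma> B (p_sub C \<Gamma> A))"

definition ty_comp ::
  "('con, 'sub, 'ty, 'tm, 'z) cwf_scheme \<Rightarrow> 'con \<Rightarrow> 'ty \<Rightarrow> 'ty \<Rightarrow> 'ty \<Rightarrow> 'tm \<Rightarrow> 'tm \<Rightarrow> 'tm" where
  "ty_comp C \<Gamma> A B D t u =
    tm_sub C (ext C \<Gamma> A) (ext C \<Gamma> B) (ty_sub C (ext C \<Gamma> B) \<Gamma> D (p_sub C \<Gamma> B)) t
      (pair_sub C (ext C \<Gamma> A) \<Gamma> B (p_sub C \<Gamma> A) u)"

definition ty_iso :: "('con, 'sub, 'ty, 'tm, 'z) cwf_scheme \<Rightarrow> 'con \<Rightarrow> 'ty \<Rightarrow> 'ty \<Rightarrow> 'tm \<Rightarrow> bool" where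
  "ty_iso C \<Gamma> A B t \<longleftrightarrow>
    t \<in> ty_hom C \<Gamma> A B \<and>
    (\<exists>u \<in> ty_hom C \<Gamma> B A.
       ty_comp C \<Gamma> B A B t u = q_tm C \<Gamma> B \<and> ty_comp C \<Gamma> A B A u t = q_tm C \<Gamma> A)"

text \<open>Reindexing \<open>t[\<sigma> \<circ> p, q]\<close> of a morphism \<open>t : A \<rightarrow> B\<close> in the type category of \<open>\<Delta>\<close>.\<close>

definition reindex ::
  "('con, 'sub, 'ty, 'tm, 'z) cwf_scheme \<Rightarrow> 'con \<Rightarrow> 'con \<Rightarrow> 'ty \<Rightarrow> 'ty \<Rightarrow> 'sub \<Rightarrow> 'tm \<Rightarrow> 'tm" where
  "reindex C \<Gamma> \<Delta> A B \<sigma> t =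
    tm_sub C (ext C \<Gamma> (ty_sub C \<Gamma> \<Delta> A \<sigma>)) (ext C \<Delta> A)
      (ty_sub C (ext C \<Delta> A) \<Delta> B (p_sub C \<Delta> A)) t (lift_sub C \<Gamma> \<Delta> A \<sigma>)"

text \<open>The term \<open>f[id, t] \<in> Tm \<Gamma> B\<close> for a morphism \<open>f : A \<rightarrow> B\<close> of the type category and \<open>t \<in> Tm \<Gamma> A\<close>.\<close>

definition ty_app ::
  "('con, 'sub, 'ty, 'tm, 'z) cwf_scheme \<Rightarrow> 'con \<Rightarrow> 'ty \<Rightarrow> 'ty \<Rightarrow> 'tm \<Rightarrow> 'tm \<Rightarrow> 'tm" where
  "ty_app C \<Gamma> A B f t =
    tm_sub C \<Gamma> (ext C \<Gamma> A) (ty_sub C (ext C \<Gamma> A) \<Gamma> B (p_sub C \<Gamma> A)) f (sect C \<Gamma> A t)"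

definition sub_inverse ::
  "('con, 'sub, 'ty, 'tm, 'z) cwf_scheme \<Rightarrow> 'con \<Rightarrow> 'con \<Rightarrow> 'sub \<Rightarrow> 'sub \<Rightarrow> bool" where
  "sub_inverse C \<Gamma> \<Delta> \<sigma> \<tau> \<longleftrightarrow>
    \<tau> \<in> Sub C \<Delta> \<Gamma> \<and> comp_sub C \<Gamma> \<Delta> \<Gamma> \<tau> \<sigma> = id_sub C \<Gamma> \<and> comp_sub C \<Delta> \<Gamma> \<Delta> \<sigma> \<tau> = id_sub C \<Delta>"

text \<open>The actions on substitutions, types and terms carry the implicit source indices.\<close>

record ('con1, 'sub1, 'ty1, 'tm1, 'con2, 'sub2, 'ty2, 'tm2) cwf_map =
  mCon :: "'con1 \<Rightarrow> 'con2"
  mSub :: "'con1 \<Rightarrow> 'con1 \<Rightarrow> 'sub1 \<Rightarrow> 'sub2"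
  mTy :: "'con1 \<Rightarrow> 'ty1 \<Rightarrow> 'ty2"
  mTm :: "'con1 \<Rightarrow> 'ty1 \<Rightarrow> 'tm1 \<Rightarrow> 'tm2"

text \<open>The comparison substitution \<open>(F p, F q) \<in> Sub (F (\<Gamma> \<triangleright> A)) (F \<Gamma> \<triangleright> F A)\<close>.\<close>

definition F_ext ::
  "('con1, 'sub1, 'ty1, 'tm1, 'z1) cwf_scheme \<Rightarrow> ('con2, 'sub2, 'ty2, 'tm2, 'z2) cwf_scheme
    \<Rightarrow> ('con1, 'sub1, 'ty1, 'tm1, 'con2, 'sub2, 'ty2, 'tm2) cwf_map
    \<Rightarrow> 'con1 \<Rightarrow> 'ty1 \<Rightarrow> 'sub2" where
  "F_ext C D F \<Gamma> A =
    pair_sub D (mCon F (ext C \<Gamma> A)) (mCon F \<Gamma>) (mTy F \<Gamma> A)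
      (mSub F (ext C \<Gamma> A) \<Gamma> (p_sub C \<Gamma> A))
      (mTm F (ext C \<Gamma> A) (ty_sub C (ext C \<Gamma> A) \<Gamma> A (p_sub C \<Gamma> A)) (q_tm C \<Gamma> A))"

definition F_ext_inv ::
  "('con1, 'sub1, 'ty1, 'tm1, 'z1) cwf_scheme \<Rightarrow> ('con2, 'sub2, 'ty2, 'tm2, 'z2) cwf_scheme
    \<Rightarrow> ('con1, 'sub1, 'ty1, 'tm1, 'con2, 'sub2, 'ty2, 'tm2) cwf_map
    \<Rightarrow> 'con1 \<Rightarrow> 'ty1 \<Rightarrow> 'sub2" where
  "F_ext_inv C D F \<Gamma> A =
    (THE \<tau>. sub_inverse D (mCon F (ext C \<Gamma> A)) (ext D (mCon F \<Gamma>) (mTy F \<Gamma> A)) (F_ext C D F \<Gamma> A) \<tau>)"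

text \<open>
  The type \<open>(F B)[F_ext_inv]\<close> over \<open>F \<Gamma> \<triangleright> F A\<close>, for \<open>B\<close> a type over \<open>\<Gamma> \<triangleright> A\<close>.
\<close>

definition mTy_ext ::
  "('con1, 'sub1, 'ty1, 'tm1, 'z1) cwf_scheme \<Rightarrow> ('con2, 'sub2, 'ty2, 'tm2, 'z2) cwf_scheme
    \<Rightarrow> ('con1, 'sub1, 'ty1, 'tm1, 'con2, 'sub2, 'ty2, 'tm2) cwf_map
    \<Rightarrow> 'con1 \<Rightarrow> 'ty1 \<Rightarrow> 'ty1 \<Rightarrow> 'ty2" where
  "mTy_ext C D F \<Gamma> A B =
    ty_sub D (ext D (mCon F \<Gamma>) (mTy F \<Gamma> A)) (mCon F (ext C \<Gamma> A)) (mTy F (ext C \<Gamma> A) B)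
      (F_ext_inv C D F \<Gamma> A)"

locale weak_flcwf_morphism = C: flcwf C + D: flcwf D
  for C :: "('con1, 'sub1, 'ty1, 'tm1, 'z1) flcwf_scheme"
    and D :: "('con2, 'sub2, 'ty2, 'tm2, 'z2) flcwf_scheme" +
  fixes F :: "('con1, 'sub1, 'ty1, 'tm1, 'con2, 'sub2, 'ty2, 'tm2) cwf_map"
  assumes mCon_closed: "\<Gamma> \<in> Con C \<Longrightarrow> mCon F \<Gamma> \<in> Con D"
    and mSub_closed:
      "\<lbrakk>\<Gamma> \<in> Con C; \<Delta> \<in> Con C; \<sigma> \<in> Sub C \<Gamma> \<Delta>\<rbrakk> \<Longrightarrow> mSub F \<Gamma> \<Delta> \<sigma> \<in> Sub D (mCon F \<Gamma>) (mCon F \<Delta>)"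
    and mSub_id: "\<Gamma> \<in> Con C \<Longrightarrow> mSub F \<Gamma> \<Gamma> (id_sub C \<Gamma>) = id_sub D (mCon F \<Gamma>)"
    and mSub_comp:
      "\<lbrakk>\<Gamma> \<in> Con C; \<Delta> \<in> Con C; \<Theta> \<in> Con C; \<delta> \<in> Sub C \<Gamma> \<Delta>; \<sigma> \<in> Sub C \<Delta> \<Theta>\<rbrakk>
        \<Longrightarrow> mSub F \<Gamma> \<Theta> (comp_sub C \<Gamma> \<Delta> \<Theta> \<sigma> \<delta>)
          = comp_sub D (mCon F \<Gamma>) (mCon F \<Delta>) (mCon F \<Theta>) (mSub F \<Delta> \<Theta> \<sigma>) (mSub F \<Gamma> \<Delta> \<delta>)"
    and mTy_closed: "\<lbrakk>\<Gamma> \<in> Con C; A \<in> Ty C \<Gamma>\<rbrakk> \<Longrightarrow> mTy F \<Gamma> A \<in> Ty D (mCon F \<Gamma>)"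
    and mTm_closed:
      "\<lbrakk>\<Gamma> \<in> Con C; A \<in> Ty C \<Gamma>; t \<in> Tm C \<Gamma> A\<rbrakk> \<Longrightarrow> mTm F \<Gamma> A t \<in> Tm D (mCon F \<Gamma>) (mTy F \<Gamma> A)"
    and mTy_sub:
      "\<lbrakk>\<Gamma> \<in> Con C; \<Delta> \<in> Con C; A \<in> Ty C \<Delta>; \<sigma> \<in> Sub C \<Gamma> \<Delta>\<rbrakk>
        \<Longrightarrow> mTy F \<Gamma> (ty_sub C \<Gamma> \<Delta> A \<sigma>)
          = ty_sub D (mCon F \<Gamma>) (mCon F \<Delta>) (mTy F \<Delta> A) (mSub F \<Gamma> \<Delta> \<sigma>)"
    and mTm_sub:
      "\<lbrakk>\<Gamma> \<in> Con C; \<Delta> \<in> Con C; A \<in> Ty C \<Delta>; t \<in> Tm C \<Delta> A; \<sigma> \<in> Sub C \<Gamma> \<Delta>\<rbrakk>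
        \<Longrightarrow> mTm F \<Gamma> (ty_sub C \<Gamma> \<Delta> A \<sigma>) (tm_sub C \<Gamma> \<Delta> A t \<sigma>)
          = tm_sub D (mCon F \<Gamma>) (mCon F \<Delta>) (mTy F \<Delta> A) (mTm F \<Delta> A t) (mSub F \<Gamma> \<Delta> \<sigma>)"
    and emp_retraction:
      "\<exists>\<rho> \<in> Sub D (emp D) (mCon F (emp C)).
         comp_sub D (mCon F (emp C)) (emp D) (mCon F (emp C)) \<rho> (eps D (mCon F (emp C)))
           = id_sub D (mCon F (emp C))"
    and ext_inverse:
      "\<lbrakk>\<Gamma> \<in> Con C; A \<in> Ty C \<Gamma>\<rbrakk>
        \<Longrightarrow> \<exists>\<tau>. sub_inverse D (mCon F (ext C \<Gamma> A)) (ext D (mCon F \<Gamma>) (mTy F \<Gamma> A))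
                 (F_ext C D F \<Gamma> A) \<tau>"

end

theory Submission
  imports Defs
begin

text \<open>
  For each type former \<open>T\<close> the constructors and destructors give an operation from terms of \<open>T\<close> in \<open>C\<close>
  to terms of the corresponding type \<open>S\<close> in \<open>D\<close>, natural in the substitutions of \<open>C\<close>: apply the
  destructors, then \<open>F\<close>, then the constructors.  Evaluated at the generic term \<open>q\<close> of \<open>\<Gamma> \<triangleright> T\<close> and
  transported along \<open>F (\<Gamma> \<triangleright> T) \<simeq> F \<Gamma> \<triangleright> F T\<close> it is the desired morphism \<open>F T \<rightarrow> S\<close>; naturality of the
  operation yields naturality and the preservation equations.

  The inverses are explicit.  For \<open>\<Sigma>\<close> it is \<open>F\<close> of the generic pair over \<open>\<Gamma> \<triangleright> A \<triangleright> B\<close>, pulled back along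
  \<open>(p, proj1 q, proj2 q)\<close>.  For \<open>K\<close> it is \<open>F (lamK id)\<close> over \<open>F \<Delta>\<close>, pulled back along \<open>appK q\<close>; this has the
  right type because \<open>K \<Delta>\<close> comes from the empty context and \<open>F \<bullet>\<close> is terminal.  For \<open>Id\<close> it is
  \<open>(F refl)[p]\<close>, which has the right type by equality reflection, and all equations hold by uniqueness
  of identity proofs.
\<close>


section \<open>Normalization of substitutions\<close>

text \<open>
  Nested substitutions are normalized to \<open>A[\<sigma> \<circ> \<delta>]\<close>.  As this also rewrites the type indices of the term
  operations, the rules take such an index as a variable \<open>A'\<close> with an equational premise.
\<close>

context cwf
begin

lemma ty_sub_ty_sub:
  "\<lbrakk>\<Gamma> \<in> Con C; \<Delta> \<in> Con C; \<Theta> \<in> Con C; A \<in> Ty C \<Theta>; \<delta> \<in> Sub C \<Gamma> \<Delta>; \<sigma> \<in> Sub C \<Delta> \<Theta>\<rbrakk>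
    \<Longrightarrow> ty_sub C \<Gamma> \<Delta> (ty_sub C \<Delta> \<Theta> A \<sigma>) \<delta> = ty_sub C \<Gamma> \<Theta> A (comp_sub C \<Gamma> \<Delta> \<Theta> \<sigma> \<delta>)"
  by (simp add: ty_sub_comp)

lemma tm_sub_tm_sub:
  "\<lbrakk>\<Gamma> \<in> Con C; \<Delta> \<in> Con C; \<Theta> \<in> Con C; A \<in> Ty C \<Theta>; t \<in> Tm C \<Theta> A; \<delta> \<in> Sub C \<Gamma> \<Delta>; \<sigma> \<in> Sub C \<Delta> \<Theta>;
    A' = ty_sub C \<Delta> \<Theta> A \<sigma>\<rbrakk>
    \<Longrightarrow> tm_sub C \<Gamma> \<Delta> A' (tm_sub C \<Delta> \<Theta> A t \<sigma>) \<delta> = tm_sub C \<Gamma> \<Theta> A t (comp_sub C \<Gamma> \<Delta> \<Theta> \<sigma> \<delta>)"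
  by (simp add: tm_sub_comp)

lemma tm_sub_in_Tm:
  "\<lbrakk>\<Gamma> \<in> Con C; \<Delta> \<in> Con C; A \<in> Ty C \<Delta>; t \<in> Tm C \<Delta> A; \<sigma> \<in> Sub C \<Gamma> \<Delta>; A' = ty_sub C \<Gamma> \<Delta> A \<sigma>\<rbrakk>
    \<Longrightarrow> tm_sub C \<Gamma> \<Delta> A t \<sigma> \<in> Tm C \<Gamma> A'"
  by (simp add: tm_sub_closed)

lemma q_tm_in_Tm:
  "\<lbrakk>\<Gamma> \<in> Con C; A \<in> Ty C \<Gamma>; A' = ty_sub C (ext C \<Gamma> A) \<Gamma> A (p_sub C \<Gamma> A)\<rbrakk>
    \<Longrightarrow> q_tm C \<Gamma> A \<in> Tm C (ext C \<Gamma> A) A'"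
  by (simp add: q_tm_closed)

lemma q_tm_pair:
  "\<lbrakk>\<Gamma> \<in> Con C; \<Delta> \<in> Con C; A \<in> Ty C \<Delta>; \<sigma> \<in> Sub C \<Gamma> \<Delta>; t \<in> Tm C \<Gamma> (ty_sub C \<Gamma> \<Delta> A \<sigma>);
    A' = ty_sub C (ext C \<Delta> A) \<Delta> A (p_sub C \<Delta> A)\<rbrakk>
    \<Longrightarrow> tm_sub C \<Gamma> (ext C \<Delta> A) A' (q_tm C \<Delta> A) (pair_sub C \<Gamma> \<Delta> A \<sigma> t) = t"
  by (simp add: q_tm_beta)

lemma pair_eta:
  "\<lbrakk>\<Gamma> \<in> Con C; \<Delta> \<in> Con C; A \<in> Ty C \<Delta>; \<sigma> \<in> Sub C \<Gamma> (ext C \<Delta> A);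
    A' = ty_sub C (ext C \<Delta> A) \<Delta> A (p_sub C \<Delta> A)\<rbrakk>
    \<Longrightarrow> pair_sub C \<Gamma> \<Delta> A (comp_sub C \<Gamma> (ext C \<Delta> A) \<Delta> (p_sub C \<Delta> A) \<sigma>)
          (tm_sub C \<Gamma> (ext C \<Delta> A) A' (q_tm C \<Delta> A) \<sigma>) = \<sigma>"
  by (simp add: pair_sub_eta)

text \<open>Eta at the identity substitution.\<close>

lemma pair_p_q:
  assumes "\<Delta> \<in> Con C" "A \<in> Ty C \<Delta>"
  shows "pair_sub C (ext C \<Delta> A) \<Delta> A (p_sub C \<Delta> A) (q_tm C \<Delta> A) = id_sub C (ext C \<Delta> A)"
  using pair_sub_eta[of "ext C \<Delta> A" \<Delta> A "id_sub C (ext C \<Delta> A)"] assms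
  by (simp add: ext_closed id_sub_closed comp_id_right p_sub_closed tm_sub_id ty_sub_closed q_tm_closed)

lemma p_pair_comp:
  "\<lbrakk>\<Gamma> \<in> Con C; \<Delta> \<in> Con C; \<Theta> \<in> Con C; A \<in> Ty C \<Delta>; \<sigma> \<in> Sub C \<Gamma> \<Delta>; t \<in> Tm C \<Gamma> (ty_sub C \<Gamma> \<Delta> A \<sigma>);
    \<delta> \<in> Sub C \<Theta> \<Gamma>\<rbrakk>
    \<Longrightarrow> comp_sub C \<Theta> (ext C \<Delta> A) \<Delta> (p_sub C \<Delta> A) (comp_sub C \<Theta> \<Gamma> (ext C \<Delta> A) (pair_sub C \<Gamma> \<Delta> A \<sigma> t) \<delta>)
      = comp_sub C \<Theta> \<Gamma> \<Delta> \<sigma> \<delta>"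
  by (simp add: comp_assoc[symmetric] ext_closed p_sub_closed pair_sub_closed p_sub_beta)

text \<open>By eta, a substitution into \<open>ext C \<Delta> A\<close> is determined by its
  composite with \<open>p\<close> and its action on \<open>q\<close>; both are computed for the left
  side and fed back into eta.\<close>

lemma pair_comp:
  assumes "\<Gamma> \<in> Con C" "\<Delta> \<in> Con C" "\<Theta> \<in> Con C" "A \<in> Ty C \<Delta>" "\<sigma> \<in> Sub C \<Gamma> \<Delta>"
    "t \<in> Tm C \<Gamma> (ty_sub C \<Gamma> \<Delta> A \<sigma>)" "\<delta> \<in> Sub C \<Theta> \<Gamma>"
  shows "comp_sub C \<Theta> \<Gamma> (ext C \<Delta> A) (pair_sub C \<Gamma> \<Delta> A \<sigma> t) \<delta>
    = pair_sub C \<Theta> \<Delta> A (comp_sub C \<Theta> \<Gamma> \<Delta> \<sigma> \<delta>) (tm_sub C \<Theta> \<Gamma> (ty_sub C \<Gamma> \<Delta> A \<sigma>) t \<delta>)"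
proof -
  let ?\<rho> = "comp_sub C \<Theta> \<Gamma> (ext C \<Delta> A) (pair_sub C \<Gamma> \<Delta> A \<sigma> t) \<delta>"
  let ?A = "ty_sub C (ext C \<Delta> A) \<Delta> A (p_sub C \<Delta> A)"
  note closed = ext_closed p_sub_closed pair_sub_closed ty_sub_closed q_tm_closed comp_closed
  have "tm_sub C \<Theta> (ext C \<Delta> A) ?A (q_tm C \<Delta> A) ?\<rho> = tm_sub C \<Theta> \<Gamma> (ty_sub C \<Gamma> \<Delta> A \<sigma>) t \<delta>"
    using tm_sub_comp[of \<Theta> \<Gamma> "ext C \<Delta> A" ?A "q_tm C \<Delta> A" \<delta> "pair_sub C \<Gamma> \<Delta> A \<sigma> t"] assms
    by (simp add: closed q_tm_beta ty_sub_ty_sub p_sub_beta)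
  with pair_sub_eta[of \<Theta> \<Delta> A ?\<rho>] assms show ?thesis
    by (simp add: closed p_pair_comp)
qed

lemmas cwf_closed = id_sub_closed comp_closed ty_sub_closed tm_sub_in_Tm emp_closed eps_closed
  ext_closed p_sub_closed q_tm_in_Tm pair_sub_closed

text \<open>Oriented towards a normal form: composites nest to the right, and a pair absorbs
  whatever is composed on its right, so that the beta rules can fire.\<close>

lemmas cwf_simps = comp_id_left comp_id_right comp_assoc ty_sub_id ty_sub_ty_sub tm_sub_id
  tm_sub_tm_sub p_sub_beta q_tm_pair pair_eta pair_p_q pair_comp

section \<open>Types over an extended context, along a lifted substitution\<close>

text \<open>The second argument of a substituted \<Sigma>-type; as a constant it stays folded under
  simplification.\<close>

definition lift_ty :: "'con \<Rightarrow> 'con \<Rightarrow> 'ty \<Rightarrow> 'ty \<Rightarrow> 'sub \<Rightarrow> 'ty" where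
  "lift_ty \<Gamma> \<Delta> A B \<sigma> = ty_sub C (ext C \<Gamma> (ty_sub C \<Gamma> \<Delta> A \<sigma>)) (ext C \<Delta> A) B (lift_sub C \<Gamma> \<Delta> A \<sigma>)"

lemma lift_ty_closed:
  "\<lbrakk>\<Gamma> \<in> Con C; \<Delta> \<in> Con C; A \<in> Ty C \<Delta>; B \<in> Ty C (ext C \<Delta> A); \<sigma> \<in> Sub C \<Gamma> \<Delta>; A' = ty_sub C \<Gamma> \<Delta> A \<sigma>\<rbrakk>
    \<Longrightarrow> lift_ty \<Gamma> \<Delta> A B \<sigma> \<in> Ty C (ext C \<Gamma> A')"
  by (simp add: cwf_closed cwf_simps lift_ty_def lift_sub_def Let_def)

text \<open>Lifting is functorial: \<open>(\<sigma> \<circ> p, q) \<circ> (\<delta> \<circ> p, q) =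
  (\<sigma> \<circ> \<delta> \<circ> p, q)\<close>.\<close>

lemma lift_ty_comp:
  "\<lbrakk>\<Gamma> \<in> Con C; \<Delta> \<in> Con C; \<Theta> \<in> Con C; A \<in> Ty C \<Theta>; B \<in> Ty C (ext C \<Theta> A); \<sigma> \<in> Sub C \<Delta> \<Theta>; \<delta> \<in> Sub C \<Gamma> \<Delta>;
    A' = ty_sub C \<Delta> \<Theta> A \<sigma>\<rbrakk>
    \<Longrightarrow> lift_ty \<Gamma> \<Delta> A' (lift_ty \<Delta> \<Theta> A B \<sigma>) \<delta> = lift_ty \<Gamma> \<Theta> A B (comp_sub C \<Gamma> \<Delta> \<Theta> \<sigma> \<delta>)"
  by (simp add: cwf_closed cwf_simps lift_ty_def lift_sub_def Let_def)

lemma lift_ty_id: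
  "\<lbrakk>\<Gamma> \<in> Con C; A \<in> Ty C \<Gamma>; B \<in> Ty C (ext C \<Gamma> A)\<rbrakk> \<Longrightarrow> lift_ty \<Gamma> \<Gamma> A B (id_sub C \<Gamma>) = B"
  by (simp add: cwf_closed cwf_simps lift_ty_def lift_sub_def Let_def)

text \<open>Here \<open>(\<sigma> \<circ> p, q) \<circ> (\<delta>, t) = (\<sigma> \<circ> \<delta>,
  t)\<close>. With \<delta> the identity this computes the type of a second projection.\<close>

lemma lift_ty_pair:
  "\<lbrakk>\<Gamma> \<in> Con C; \<Delta> \<in> Con C; \<Theta> \<in> Con C; A \<in> Ty C \<Theta>; B \<in> Ty C (ext C \<Theta> A); \<sigma> \<in> Sub C \<Delta> \<Theta>; \<delta> \<in> Sub C \<Gamma> \<Delta>;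
    A' = ty_sub C \<Delta> \<Theta> A \<sigma>; t \<in> Tm C \<Gamma> (ty_sub C \<Gamma> \<Delta> A' \<delta>)\<rbrakk>
    \<Longrightarrow> ty_sub C \<Gamma> (ext C \<Delta> A') (lift_ty \<Delta> \<Theta> A B \<sigma>) (pair_sub C \<Gamma> \<Delta> A' \<delta> t)
      = ty_sub C \<Gamma> (ext C \<Theta> A) B (pair_sub C \<Gamma> \<Theta> A (comp_sub C \<Gamma> \<Delta> \<Theta> \<sigma> \<delta>) t)"
  by (simp add: cwf_closed cwf_simps lift_ty_def lift_sub_def Let_def)

lemma reindex_closed:
  "\<lbrakk>\<Gamma> \<in> Con C; \<Delta> \<in> Con C; A \<in> Ty C \<Delta>; B \<in> Ty C \<Delta>; \<sigma> \<in> Sub C \<Gamma> \<Delta>;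
    t \<in> Tm C (ext C \<Delta> A) (ty_sub C (ext C \<Delta> A) \<Delta> B (p_sub C \<Delta> A))\<rbrakk>
    \<Longrightarrow> reindex C \<Gamma> \<Delta> A B \<sigma> t \<in> Tm C (ext C \<Gamma> (ty_sub C \<Gamma> \<Delta> A \<sigma>))
      (ty_sub C (ext C \<Gamma> (ty_sub C \<Gamma> \<Delta> A \<sigma>)) \<Gamma> (ty_sub C \<Gamma> \<Delta> B \<sigma>) (p_sub C \<Gamma> (ty_sub C \<Gamma> \<Delta> A \<sigma>)))"
  by (simp add: cwf_closed cwf_simps reindex_def lift_sub_def Let_def)

lemma ty_app_closed:
  "\<lbrakk>\<Gamma> \<in> Con C; A \<in> Ty C \<Gamma>; B \<in> Ty C \<Gamma>; t \<in> Tm C \<Gamma> A;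
    f \<in> Tm C (ext C \<Gamma> A) (ty_sub C (ext C \<Gamma> A) \<Gamma> B (p_sub C \<Gamma> A))\<rbrakk>
    \<Longrightarrow> ty_app C \<Gamma> A B f t \<in> Tm C \<Gamma> B"
  by (simp add: cwf_closed cwf_simps ty_app_def sect_def)

lemma ty_isoI:
  assumes "\<Gamma> \<in> Con C" "A \<in> Ty C \<Gamma>" "B \<in> Ty C \<Gamma>"
    and "t \<in> Tm C (ext C \<Gamma> A) (ty_sub C (ext C \<Gamma> A) \<Gamma> B (p_sub C \<Gamma> A))"
    and "u \<in> Tm C (ext C \<Gamma> B) (ty_sub C (ext C \<Gamma> B) \<Gamma> A (p_sub C \<Gamma> B))"
    and "tm_sub C (ext C \<Gamma> B) (ext C \<Gamma> A) (ty_sub C (ext C \<Gamma> A) \<Gamma> B (p_sub C \<Gamma> A)) t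
      (pair_sub C (ext C \<Gamma> B) \<Gamma> A (p_sub C \<Gamma> B) u) = q_tm C \<Gamma> B"
    and "tm_sub C (ext C \<Gamma> A) (ext C \<Gamma> B) (ty_sub C (ext C \<Gamma> B) \<Gamma> A (p_sub C \<Gamma> B)) u
      (pair_sub C (ext C \<Gamma> A) \<Gamma> B (p_sub C \<Gamma> A) t) = q_tm C \<Gamma> A"
  shows "ty_iso C \<Gamma> A B t"
  using assms unfolding ty_iso_def ty_hom_def ty_comp_def by blast

end

section \<open>The fl-structure under a substitution\<close>

text \<open>
  Formers for \<open>(Sig A B)[\<sigma>]\<close> that keep \<open>A\<close> and \<open>B\<close> fixed, so that substitution only acts on \<open>\<sigma>\<close>.
\<close>

context flcwf
begin

definition proj1_at :: "'con \<Rightarrow> 'con \<Rightarrow> 'ty \<Rightarrow> 'ty \<Rightarrow> 'sub \<Rightarrow> 'tm \<Rightarrow> 'tm" where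
  "proj1_at \<Gamma> \<Delta> A B \<sigma> t = proj1 C \<Gamma> (ty_sub C \<Gamma> \<Delta> A \<sigma>) (lift_ty \<Gamma> \<Delta> A B \<sigma>) t"

definition proj2_at :: "'con \<Rightarrow> 'con \<Rightarrow> 'ty \<Rightarrow> 'ty \<Rightarrow> 'sub \<Rightarrow> 'tm \<Rightarrow> 'tm" where
  "proj2_at \<Gamma> \<Delta> A B \<sigma> t = proj2 C \<Gamma> (ty_sub C \<Gamma> \<Delta> A \<sigma>) (lift_ty \<Gamma> \<Delta> A B \<sigma>) t"

definition spair_at :: "'con \<Rightarrow> 'con \<Rightarrow> 'ty \<Rightarrow> 'ty \<Rightarrow> 'sub \<Rightarrow> 'tm \<Rightarrow> 'tm \<Rightarrow> 'tm" where
  "spair_at \<Gamma> \<Delta> A B \<sigma> t u = spair C \<Gamma> (ty_sub C \<Gamma> \<Delta> A \<sigma>) (lift_ty \<Gamma> \<Delta> A B \<sigma>) t u"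

lemma Sig_lift_ty:
  "\<lbrakk>\<Gamma> \<in> Con C; \<Delta> \<in> Con C; A \<in> Ty C \<Delta>; B \<in> Ty C (ext C \<Delta> A); \<sigma> \<in> Sub C \<Gamma> \<Delta>\<rbrakk>
    \<Longrightarrow> ty_sub C \<Gamma> \<Delta> (Sig C \<Delta> A B) \<sigma> = Sig C \<Gamma> (ty_sub C \<Gamma> \<Delta> A \<sigma>) (lift_ty \<Gamma> \<Delta> A B \<sigma>)"
  by (simp add: Sig_sub lift_ty_def)

context
  fixes \<Gamma> \<Delta> A B \<sigma>
  assumes base: "\<Gamma> \<in> Con C" "\<Delta> \<in> Con C" "A \<in> Ty C \<Delta>" "B \<in> Ty C (ext C \<Delta> A)" "\<sigma> \<in> Sub C \<Gamma> \<Delta>"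
begin

lemma proj1_at_closed:
  "\<lbrakk>t \<in> Tm C \<Gamma> (ty_sub C \<Gamma> \<Delta> (Sig C \<Delta> A B) \<sigma>); X = ty_sub C \<Gamma> \<Delta> A \<sigma>\<rbrakk>
    \<Longrightarrow> proj1_at \<Gamma> \<Delta> A B \<sigma> t \<in> Tm C \<Gamma> X"
  using base by (simp add: proj1_at_def Sig_lift_ty proj1_closed lift_ty_closed ty_sub_closed)

lemma proj2_at_closed:
  "\<lbrakk>t \<in> Tm C \<Gamma> (ty_sub C \<Gamma> \<Delta> (Sig C \<Delta> A B) \<sigma>);
    X = ty_sub C \<Gamma> (ext C \<Delta> A) B (pair_sub C \<Gamma> \<Delta> A \<sigma> (proj1_at \<Gamma> \<Delta> A B \<sigma> t))\<rbrakk>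
    \<Longrightarrow> proj2_at \<Gamma> \<Delta> A B \<sigma> t \<in> Tm C \<Gamma> X"
  using base proj2_closed[of \<Gamma> "ty_sub C \<Gamma> \<Delta> A \<sigma>" "lift_ty \<Gamma> \<Delta> A B \<sigma>" t]
    proj1_closed[of \<Gamma> "ty_sub C \<Gamma> \<Delta> A \<sigma>" "lift_ty \<Gamma> \<Delta> A B \<sigma>" t]
  by (simp add: proj1_at_def proj2_at_def Sig_lift_ty lift_ty_closed cwf_closed sect_def lift_ty_pair
      ty_sub_id comp_id_right)

context
  fixes t u
  assumes t: "t \<in> Tm C \<Gamma> (ty_sub C \<Gamma> \<Delta> A \<sigma>)"
    and u: "u \<in> Tm C \<Gamma> (ty_sub C \<Gamma> (ext C \<Delta> A) B (pair_sub C \<Gamma> \<Delta> A \<sigma> t))"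
begin

private lemma u_lift_ty:
  "u \<in> Tm C \<Gamma> (ty_sub C \<Gamma> (ext C \<Gamma> (ty_sub C \<Gamma> \<Delta> A \<sigma>)) (lift_ty \<Gamma> \<Delta> A B \<sigma>)
    (sect C \<Gamma> (ty_sub C \<Gamma> \<Delta> A \<sigma>) t))"
  using base t u
  by (simp add: sect_def cwf_closed lift_ty_pair ty_sub_id comp_id_right)

lemma spair_at_closed: "X = ty_sub C \<Gamma> \<Delta> (Sig C \<Delta> A B) \<sigma> \<Longrightarrow> spair_at \<Gamma> \<Delta> A B \<sigma> t u \<in> Tm C \<Gamma> X"
  using base t u_lift_ty by (simp add: spair_at_def Sig_lift_ty spair_closed lift_ty_closed ty_sub_closed)

lemma proj1_at_spair_at: "proj1_at \<Gamma> \<Delta> A B \<sigma> (spair_at \<Gamma> \<Delta> A B \<sigma> t u) = t"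
  using base t u_lift_ty
  by (simp add: spair_at_def proj1_at_def proj1_beta lift_ty_closed ty_sub_closed)

lemma proj2_at_spair_at: "proj2_at \<Gamma> \<Delta> A B \<sigma> (spair_at \<Gamma> \<Delta> A B \<sigma> t u) = u"
  using base t u_lift_ty
  by (simp add: spair_at_def proj2_at_def proj2_beta lift_ty_closed ty_sub_closed)

text \<open>\<open>spair_sub\<close> for data already substituted along \<sigma>;
  \<open>lift_ty_comp\<close> merges the two substitutions.\<close>

lemma spair_at_subst:
  assumes "\<Theta> \<in> Con C" "\<delta> \<in> Sub C \<Theta> \<Gamma>" and X: "X = ty_sub C \<Gamma> \<Delta> (Sig C \<Delta> A B) \<sigma>"
  shows "tm_sub C \<Theta> \<Gamma> X (spair_at \<Gamma> \<Delta> A B \<sigma> t u) \<delta>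
    = spair_at \<Theta> \<Delta> A B (comp_sub C \<Theta> \<Gamma> \<Delta> \<sigma> \<delta>) (tm_sub C \<Theta> \<Gamma> (ty_sub C \<Gamma> \<Delta> A \<sigma>) t \<delta>)
        (tm_sub C \<Theta> \<Gamma> (ty_sub C \<Gamma> (ext C \<Delta> A) B (pair_sub C \<Gamma> \<Delta> A \<sigma> t)) u \<delta>)"
proof -
  let ?A = "ty_sub C \<Gamma> \<Delta> A \<sigma>" and ?B = "lift_ty \<Gamma> \<Delta> A B \<sigma>"
  have "ty_sub C \<Gamma> (ext C \<Gamma> ?A) ?B (sect C \<Gamma> ?A t)
    = ty_sub C \<Gamma> (ext C \<Delta> A) B (pair_sub C \<Gamma> \<Delta> A \<sigma> t)"
    using base t by (simp add: sect_def cwf_closed lift_ty_pair ty_sub_id comp_id_right)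
  then show ?thesis
    using spair_sub[of \<Theta> \<Gamma> ?A ?B \<delta> t u, folded lift_ty_def] base t u_lift_ty assms
    by (simp add: spair_at_def Sig_lift_ty lift_ty_closed ty_sub_closed lift_ty_comp ty_sub_ty_sub)
qed

end

lemma spair_at_eta:
  "t \<in> Tm C \<Gamma> (ty_sub C \<Gamma> \<Delta> (Sig C \<Delta> A B) \<sigma>)
    \<Longrightarrow> spair_at \<Gamma> \<Delta> A B \<sigma> (proj1_at \<Gamma> \<Delta> A B \<sigma> t) (proj2_at \<Gamma> \<Delta> A B \<sigma> t) = t"
  using base
  by (simp add: spair_at_def proj1_at_def proj2_at_def Sig_lift_ty spair_eta lift_ty_closed ty_sub_closed)

end

context
  fixes \<Gamma> \<Delta> \<Theta> A B \<sigma> \<delta> t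
  assumes base: "\<Gamma> \<in> Con C" "\<Delta> \<in> Con C" "A \<in> Ty C \<Delta>" "B \<in> Ty C (ext C \<Delta> A)" "\<sigma> \<in> Sub C \<Gamma> \<Delta>"
    and \<delta>: "\<Theta> \<in> Con C" "\<delta> \<in> Sub C \<Theta> \<Gamma>" and t: "t \<in> Tm C \<Gamma> (ty_sub C \<Gamma> \<Delta> (Sig C \<Delta> A B) \<sigma>)"
begin

text \<open>Eta writes \<open>t\<close> as a pair, and pairing is stable under substitution. The
  beta laws then yield stability of both projections.\<close>

private lemma subst_eta:
  "tm_sub C \<Theta> \<Gamma> (ty_sub C \<Gamma> \<Delta> (Sig C \<Delta> A B) \<sigma>) t \<delta>
    = spair_at \<Theta> \<Delta> A B (comp_sub C \<Theta> \<Gamma> \<Delta> \<sigma> \<delta>)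
      (tm_sub C \<Theta> \<Gamma> (ty_sub C \<Gamma> \<Delta> A \<sigma>) (proj1_at \<Gamma> \<Delta> A B \<sigma> t) \<delta>)
      (tm_sub C \<Theta> \<Gamma> (ty_sub C \<Gamma> (ext C \<Delta> A) B (pair_sub C \<Gamma> \<Delta> A \<sigma> (proj1_at \<Gamma> \<Delta> A B \<sigma> t)))
        (proj2_at \<Gamma> \<Delta> A B \<sigma> t) \<delta>)"
  using spair_at_subst[OF base proj1_at_closed[OF base t refl] proj2_at_closed[OF base t refl] \<delta> refl]
  by (simp add: base t spair_at_eta)

lemma proj1_at_subst:
  "X = ty_sub C \<Gamma> \<Delta> A \<sigma> \<Longrightarrow> tm_sub C \<Theta> \<Gamma> X (proj1_at \<Gamma> \<Delta> A B \<sigma> t) \<delta>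
    = proj1_at \<Theta> \<Delta> A B (comp_sub C \<Theta> \<Gamma> \<Delta> \<sigma> \<delta>) (tm_sub C \<Theta> \<Gamma> (ty_sub C \<Gamma> \<Delta> (Sig C \<Delta> A B) \<sigma>) t \<delta>)"
  using base \<delta> t unfolding subst_eta
  by (subst proj1_at_spair_at) (simp_all add: cwf_closed cwf_simps proj1_at_closed proj2_at_closed)

lemma proj2_at_subst:
  "X = ty_sub C \<Gamma> (ext C \<Delta> A) B (pair_sub C \<Gamma> \<Delta> A \<sigma> (proj1_at \<Gamma> \<Delta> A B \<sigma> t))
    \<Longrightarrow> tm_sub C \<Theta> \<Gamma> X (proj2_at \<Gamma> \<Delta> A B \<sigma> t) \<delta>
      = proj2_at \<Theta> \<Delta> A B (comp_sub C \<Theta> \<Gamma> \<Delta> \<sigma> \<delta>) (tm_sub C \<Theta> \<Gamma> (ty_sub C \<Gamma> \<Delta> (Sig C \<Delta> A B) \<sigma>) t \<delta>)"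
  using base \<delta> t unfolding subst_eta
  by (subst proj2_at_spair_at) (simp_all add: cwf_closed cwf_simps proj1_at_closed proj2_at_closed)

end

text \<open>Substituting the data along \<sigma> and then \<delta> is the same as substituting along
  the composite, so iterated formers collapse to one.\<close>

lemma
  assumes "\<Gamma> \<in> Con C" "\<Delta> \<in> Con C" "\<Theta> \<in> Con C" "A \<in> Ty C \<Theta>" "B \<in> Ty C (ext C \<Theta> A)"
    "\<sigma> \<in> Sub C \<Delta> \<Theta>" "\<delta> \<in> Sub C \<Gamma> \<Delta>"
  defines "A' \<equiv> ty_sub C \<Delta> \<Theta> A \<sigma>" and "B' \<equiv> lift_ty \<Delta> \<Theta> A B \<sigma>" and "\<nu> \<equiv> comp_sub C \<Gamma> \<Delta> \<Theta> \<sigma> \<delta>"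
  shows proj1_at_lift_ty: "proj1_at \<Gamma> \<Delta> A' B' \<delta> t = proj1_at \<Gamma> \<Theta> A B \<nu> t"
    and proj2_at_lift_ty: "proj2_at \<Gamma> \<Delta> A' B' \<delta> t = proj2_at \<Gamma> \<Theta> A B \<nu> t"
    and spair_at_lift_ty: "spair_at \<Gamma> \<Delta> A' B' \<delta> t u = spair_at \<Gamma> \<Theta> A B \<nu> t u"
  using assms(1-7) unfolding A'_def B'_def \<nu>_def
  by (simp_all add: proj1_at_def proj2_at_def spair_at_def lift_ty_comp ty_sub_ty_sub)

section \<open>Stability of \<open>appK\<close>, and identity types under substitution\<close>

text \<open>\<open>lamK_sub\<close> at \<open>appK t\<close>, with \<open>appK\<close> applied to
  both sides.\<close>

lemma appK_subst:
  assumes "\<Gamma> \<in> Con C" "\<Delta> \<in> Con C" "\<Theta> \<in> Con C" "\<sigma> \<in> Sub C \<Gamma> \<Delta>" "t \<in> Tm C \<Delta> (K C \<Delta> \<Theta>)"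
  shows "appK C \<Gamma> \<Theta> (tm_sub C \<Gamma> \<Delta> (K C \<Delta> \<Theta>) t \<sigma>) = comp_sub C \<Gamma> \<Delta> \<Theta> (appK C \<Delta> \<Theta> t) \<sigma>"
  using lamK_sub[of \<Gamma> \<Delta> \<Theta> \<sigma> "appK C \<Delta> \<Theta> t"] appK_lamK[of \<Gamma> \<Theta> "comp_sub C \<Gamma> \<Delta> \<Theta> (appK C \<Delta> \<Theta> t) \<sigma>"] assms
  by (simp add: lamK_appK appK_closed comp_closed)

text \<open>A substituted identity type is again one, so UIP applies to it, and likewise reflection
  below. The type is left in substituted form because terms over extended contexts arise in that
  form.\<close>

lemma Idt_unique:
  assumes "\<Gamma> \<in> Con C" "\<Delta> \<in> Con C" "A \<in> Ty C \<Delta>" "t \<in> Tm C \<Delta> A" "u \<in> Tm C \<Delta> A" "\<sigma> \<in> Sub C \<Gamma> \<Delta>"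
    "e \<in> Tm C \<Gamma> (ty_sub C \<Gamma> \<Delta> (Idt C \<Delta> A t u) \<sigma>)" "e' \<in> Tm C \<Gamma> (ty_sub C \<Gamma> \<Delta> (Idt C \<Delta> A t u) \<sigma>)"
  shows "e = e'"
  using assms UIP[of \<Gamma> "ty_sub C \<Gamma> \<Delta> A \<sigma>" "tm_sub C \<Gamma> \<Delta> A t \<sigma>" "tm_sub C \<Gamma> \<Delta> A u \<sigma>" e e']
  by (simp add: Idt_sub cwf_closed)

lemma Idt_reflection:
  assumes "\<Gamma> \<in> Con C" "\<Delta> \<in> Con C" "A \<in> Ty C \<Delta>" "t \<in> Tm C \<Delta> A" "u \<in> Tm C \<Delta> A" "\<sigma> \<in> Sub C \<Gamma> \<Delta>"
    "e \<in> Tm C \<Gamma> (ty_sub C \<Gamma> \<Delta> (Idt C \<Delta> A t u) \<sigma>)"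
  shows "tm_sub C \<Gamma> \<Delta> A t \<sigma> = tm_sub C \<Gamma> \<Delta> A u \<sigma>"
  using assms reflection[of \<Gamma> "ty_sub C \<Gamma> \<Delta> A \<sigma>" "tm_sub C \<Gamma> \<Delta> A t \<sigma>" "tm_sub C \<Gamma> \<Delta> A u \<sigma>" e]
  by (simp add: Idt_sub cwf_closed)

lemmas fl_closed = cwf_closed Sig_closed proj1_at_closed proj2_at_closed spair_at_closed Idt_closed
  K_closed lamK_closed appK_closed

lemmas fl_simps = cwf_simps proj1_at_spair_at proj2_at_spair_at spair_at_eta spair_at_subst
  Idt_sub K_sub appK_lamK lamK_appK

end

section \<open>The comparison isomorphism of context extension\<close>

context weak_flcwf_morphism
begin

abbreviation "ext_inv \<equiv> F_ext_inv C D F"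

text \<open>\<open>F_ext_inv\<close> is a definite description, so it meets its specification only
  once inverses are known to be unique.\<close>

lemma ext_inv_inverse:
  assumes "\<Gamma> \<in> Con C" "A \<in> Ty C \<Gamma>"
  shows "sub_inverse D (mCon F (ext C \<Gamma> A)) (ext D (mCon F \<Gamma>) (mTy F \<Gamma> A)) (F_ext C D F \<Gamma> A)
      (ext_inv \<Gamma> A)"
proof -
  let ?X = "mCon F (ext C \<Gamma> A)" and ?Y = "ext D (mCon F \<Gamma>) (mTy F \<Gamma> A)"
  let ?\<epsilon> = "F_ext C D F \<Gamma> A"
  have closed: "?X \<in> Con D" "?Y \<in> Con D" "?\<epsilon> \<in> Sub D ?X ?Y"
    using assms unfolding F_ext_def
    by (simp_all add: C.fl_closed D.fl_closed mCon_closed mTy_closed mSub_closed mTm_closed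
        mTy_sub[symmetric])
  obtain \<tau> where \<tau>: "sub_inverse D ?X ?Y ?\<epsilon> \<tau>"
    using ext_inverse assms by blast
  have "\<tau>' = \<tau>" if \<tau>': "sub_inverse D ?X ?Y ?\<epsilon> \<tau>'" for \<tau>'
  proof -
    have "\<tau>' = comp_sub D ?Y ?Y ?X \<tau>' (comp_sub D ?Y ?X ?Y ?\<epsilon> \<tau>)"
      using \<tau> \<tau>' closed by (simp add: sub_inverse_def D.comp_id_right)
    also have "\<dots> = comp_sub D ?Y ?X ?X (comp_sub D ?X ?Y ?X \<tau>' ?\<epsilon>) \<tau>"
      using \<tau> \<tau>' closed D.comp_assoc[of ?Y ?X ?Y ?X \<tau> ?\<epsilon> \<tau>'] by (auto simp: sub_inverse_def)
    also have "\<dots> = \<tau>"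
      using \<tau> \<tau>' closed by (simp add: sub_inverse_def D.comp_id_left)
    finally show ?thesis .
  qed
  with \<tau> show ?thesis
    unfolding F_ext_inv_def by (rule theI)
qed

lemma ext_inv_closed:
  "\<lbrakk>\<Gamma> \<in> Con C; A \<in> Ty C \<Gamma>; X = ext D (mCon F \<Gamma>) (mTy F \<Gamma> A)\<rbrakk>
    \<Longrightarrow> ext_inv \<Gamma> A \<in> Sub D X (mCon F (ext C \<Gamma> A))"
  using ext_inv_inverse by (simp add: sub_inverse_def)

lemma mTm_in_Tm:
  "\<lbrakk>\<Gamma> \<in> Con C; A \<in> Ty C \<Gamma>; t \<in> Tm C \<Gamma> A; A' = mTy F \<Gamma> A\<rbrakk> \<Longrightarrow> mTm F \<Gamma> A t \<in> Tm D (mCon F \<Gamma>) A'"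
  by (simp add: mTm_closed)

lemma mTm_subst:
  "\<lbrakk>\<Gamma> \<in> Con C; \<Delta> \<in> Con C; A \<in> Ty C \<Delta>; t \<in> Tm C \<Delta> A; \<sigma> \<in> Sub C \<Gamma> \<Delta>; A' = ty_sub C \<Gamma> \<Delta> A \<sigma>\<rbrakk>
    \<Longrightarrow> mTm F \<Gamma> A' (tm_sub C \<Gamma> \<Delta> A t \<sigma>)
      = tm_sub D (mCon F \<Gamma>) (mCon F \<Delta>) (mTy F \<Delta> A) (mTm F \<Delta> A t) (mSub F \<Gamma> \<Delta> \<sigma>)"
  by (simp add: mTm_sub)

lemmas m_closed = C.fl_closed D.fl_closed mCon_closed mSub_closed mTy_closed mTm_in_Tm ext_inv_closed

section \<open>Components of the comparison isomorphism\<close>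

text \<open>The first component of \<open>F_ext \<circ> ext_inv = id\<close>;
  \<open>q_ext_inv\<close> is the second.\<close>

lemma p_ext_inv:
  assumes "\<Gamma> \<in> Con C" "A \<in> Ty C \<Gamma>" "X = ext D (mCon F \<Gamma>) (mTy F \<Gamma> A)"
  shows "comp_sub D X (mCon F (ext C \<Gamma> A)) (mCon F \<Gamma>) (mSub F (ext C \<Gamma> A) \<Gamma> (p_sub C \<Gamma> A)) (ext_inv \<Gamma> A)
    = p_sub D (mCon F \<Gamma>) (mTy F \<Gamma> A)"
proof -
  let ?Y = "ext D (mCon F \<Gamma>) (mTy F \<Gamma> A)"
  have "comp_sub D ?Y ?Y (mCon F \<Gamma>) (p_sub D (mCon F \<Gamma>) (mTy F \<Gamma> A))
      (comp_sub D ?Y (mCon F (ext C \<Gamma> A)) ?Y (F_ext C D F \<Gamma> A) (ext_inv \<Gamma> A))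
        = p_sub D (mCon F \<Gamma>) (mTy F \<Gamma> A)"
    using ext_inv_inverse[of \<Gamma> A] assms by (simp add: sub_inverse_def m_closed D.fl_simps)
  then show ?thesis
    using assms unfolding F_ext_def
    by (simp add: m_closed D.p_pair_comp mTy_sub[symmetric])
qed

lemma q_ext_inv:
  assumes "\<Gamma> \<in> Con C" "A \<in> Ty C \<Gamma>" "X = ext D (mCon F \<Gamma>) (mTy F \<Gamma> A)"
    "A' = ty_sub C (ext C \<Gamma> A) \<Gamma> A (p_sub C \<Gamma> A)"
    "A'' = mTy F (ext C \<Gamma> A) A'"
  shows "tm_sub D X (mCon F (ext C \<Gamma> A)) A'' (mTm F (ext C \<Gamma> A) A' (q_tm C \<Gamma> A)) (ext_inv \<Gamma> A)
    = q_tm D (mCon F \<Gamma>) (mTy F \<Gamma> A)"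
proof -
  let ?Y = "ext D (mCon F \<Gamma>) (mTy F \<Gamma> A)"
  let ?A = "ty_sub D ?Y (mCon F \<Gamma>) (mTy F \<Gamma> A) (p_sub D (mCon F \<Gamma>) (mTy F \<Gamma> A))"
  have "tm_sub D ?Y ?Y ?A (q_tm D (mCon F \<Gamma>) (mTy F \<Gamma> A))
      (comp_sub D ?Y (mCon F (ext C \<Gamma> A)) ?Y (F_ext C D F \<Gamma> A) (ext_inv \<Gamma> A))
        = q_tm D (mCon F \<Gamma>) (mTy F \<Gamma> A)"
    using ext_inv_inverse[of \<Gamma> A] assms by (simp add: sub_inverse_def m_closed D.fl_simps)
  then show ?thesis
    using assms unfolding F_ext_def
    by (simp add: m_closed D.fl_simps mTy_sub)
qed

text \<open>The form of \<open>p_ext_inv\<close> that still matches after composites have been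
  nested to the right; \<open>q_ext_inv_comp\<close> does the same for \<open>q\<close>.\<close>

lemma p_ext_inv_comp:
  "\<lbrakk>\<Gamma> \<in> Con C; A \<in> Ty C \<Gamma>; X = ext D (mCon F \<Gamma>) (mTy F \<Gamma> A); \<Theta> \<in> Con D; \<delta> \<in> Sub D \<Theta> X\<rbrakk>
    \<Longrightarrow> comp_sub D \<Theta> (mCon F (ext C \<Gamma> A)) (mCon F \<Gamma>) (mSub F (ext C \<Gamma> A) \<Gamma> (p_sub C \<Gamma> A))
        (comp_sub D \<Theta> X (mCon F (ext C \<Gamma> A)) (ext_inv \<Gamma> A) \<delta>)
      = comp_sub D \<Theta> X (mCon F \<Gamma>) (p_sub D (mCon F \<Gamma>) (mTy F \<Gamma> A)) \<delta>"
  by (simp add: m_closed D.comp_assoc[symmetric] p_ext_inv)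

lemma q_ext_inv_comp:
  "\<lbrakk>\<Gamma> \<in> Con C; A \<in> Ty C \<Gamma>; X = ext D (mCon F \<Gamma>) (mTy F \<Gamma> A);
    A' = ty_sub C (ext C \<Gamma> A) \<Gamma> A (p_sub C \<Gamma> A); A'' = mTy F (ext C \<Gamma> A) A';
    \<Theta> \<in> Con D; \<delta> \<in> Sub D \<Theta> X\<rbrakk>
    \<Longrightarrow> tm_sub D \<Theta> (mCon F (ext C \<Gamma> A)) A'' (mTm F (ext C \<Gamma> A) A' (q_tm C \<Gamma> A))
        (comp_sub D \<Theta> X (mCon F (ext C \<Gamma> A)) (ext_inv \<Gamma> A) \<delta>)
      = tm_sub D \<Theta> X (ty_sub D X (mCon F \<Gamma>) (mTy F \<Gamma> A) (p_sub D (mCon F \<Gamma>) (mTy F \<Gamma> A)))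
          (q_tm D (mCon F \<Gamma>) (mTy F \<Gamma> A)) \<delta>"
  by (subst D.tm_sub_comp) (simp_all add: m_closed D.fl_simps q_ext_inv mTy_sub p_ext_inv)

text \<open>The other law, \<open>ext_inv \<circ> F_ext = id\<close>, composed with \<delta>;
  \<open>F_ext \<circ> \<delta>\<close> appears as the pair into which simplification expands
  it.\<close>

lemma ext_inv_eta_comp:
  assumes "\<Gamma> \<in> Con C" "A \<in> Ty C \<Gamma>" "X = ext D (mCon F \<Gamma>) A0" "A0 = mTy F \<Gamma> A"
    "A' = ty_sub C (ext C \<Gamma> A) \<Gamma> A (p_sub C \<Gamma> A)" "A'' = mTy F (ext C \<Gamma> A) A'"
    "\<Theta> \<in> Con D" "\<delta> \<in> Sub D \<Theta> (mCon F (ext C \<Gamma> A))"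
  shows "comp_sub D \<Theta> X (mCon F (ext C \<Gamma> A)) (ext_inv \<Gamma> A)
      (pair_sub D \<Theta> (mCon F \<Gamma>) A0
        (comp_sub D \<Theta> (mCon F (ext C \<Gamma> A)) (mCon F \<Gamma>) (mSub F (ext C \<Gamma> A) \<Gamma> (p_sub C \<Gamma> A)) \<delta>)
        (tm_sub D \<Theta> (mCon F (ext C \<Gamma> A)) A'' (mTm F (ext C \<Gamma> A) A' (q_tm C \<Gamma> A)) \<delta>)) = \<delta>"
proof -
  let ?X = "mCon F (ext C \<Gamma> A)" and ?Y = "ext D (mCon F \<Gamma>) (mTy F \<Gamma> A)"
  have "comp_sub D \<Theta> ?X ?X (comp_sub D ?X ?Y ?X (ext_inv \<Gamma> A) (F_ext C D F \<Gamma> A)) \<delta> = \<delta>"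
    using ext_inv_inverse[of \<Gamma> A] assms by (simp add: sub_inverse_def m_closed D.fl_simps)
  then show ?thesis
    using assms unfolding F_ext_def
    by (simp add: m_closed D.fl_simps mTy_sub)
qed

text \<open>By \<open>ext_inv_eta_comp\<close>, \<open>F \<rho>\<close> is recovered from
  \<open>F (p \<circ> \<rho>)\<close> and \<open>F (q[\<rho>])\<close>, which the beta laws of
  \<open>C\<close> evaluate. As a rewrite rule this pushes \<open>F\<close> through every
  pairing.\<close>

lemma mSub_pair:
  assumes "\<Gamma> \<in> Con C" "\<Delta> \<in> Con C" "A \<in> Ty C \<Delta>" "\<sigma> \<in> Sub C \<Gamma> \<Delta>" "t \<in> Tm C \<Gamma> (ty_sub C \<Gamma> \<Delta> A \<sigma>)"
  shows "mSub F \<Gamma> (ext C \<Delta> A) (pair_sub C \<Gamma> \<Delta> A \<sigma> t)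
    = comp_sub D (mCon F \<Gamma>) (ext D (mCon F \<Delta>) (mTy F \<Delta> A)) (mCon F (ext C \<Delta> A)) (ext_inv \<Delta> A)
        (pair_sub D (mCon F \<Gamma>) (mCon F \<Delta>) (mTy F \<Delta> A) (mSub F \<Gamma> \<Delta> \<sigma>)
          (mTm F \<Gamma> (ty_sub C \<Gamma> \<Delta> A \<sigma>) t))"
proof -
  let ?A = "ty_sub C (ext C \<Delta> A) \<Delta> A (p_sub C \<Delta> A)"
  let ?\<rho> = "pair_sub C \<Gamma> \<Delta> A \<sigma> t"
  have "mSub F \<Gamma> (ext C \<Delta> A) ?\<rho>
    = comp_sub D (mCon F \<Gamma>) (ext D (mCon F \<Delta>) (mTy F \<Delta> A)) (mCon F (ext C \<Delta> A)) (ext_inv \<Delta> A)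
        (pair_sub D (mCon F \<Gamma>) (mCon F \<Delta>) (mTy F \<Delta> A)
          (mSub F \<Gamma> \<Delta> (comp_sub C \<Gamma> (ext C \<Delta> A) \<Delta> (p_sub C \<Delta> A) ?\<rho>))
          (mTm F \<Gamma> (ty_sub C \<Gamma> (ext C \<Delta> A) ?A ?\<rho>) (tm_sub C \<Gamma> (ext C \<Delta> A) ?A (q_tm C \<Delta> A) ?\<rho>)))"
    using assms by (simp add: m_closed mSub_comp mTm_sub ext_inv_eta_comp)
  then show ?thesis
    using assms by (simp add: m_closed C.fl_simps)
qed

lemmas m_simps = C.fl_simps D.fl_simps mSub_id mSub_comp mTy_sub mTm_subst p_ext_inv q_ext_inv p_ext_inv_comp q_ext_inv_comp
  ext_inv_eta_comp mSub_pair mTy_ext_def Let_def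

section \<open>From terms over \<open>F (\<Gamma> \<triangleright> T)\<close> to morphisms
  \<open>F T \<rightarrow> S\<close>\<close>

text \<open>The argument has type \<open>S[F p]\<close>; since
  \<open>F p \<circ> ext_inv = p\<close>, its transport has type \<open>S[p]\<close>, as a morphism
  of the type category over \<open>F \<Gamma>\<close> must.\<close>

definition pull :: "'con1 \<Rightarrow> 'ty1 \<Rightarrow> 'ty2 \<Rightarrow> 'tm2 \<Rightarrow> 'tm2" where
  "pull \<Gamma> T S \<phi> = tm_sub D (ext D (mCon F \<Gamma>) (mTy F \<Gamma> T)) (mCon F (ext C \<Gamma> T))
    (ty_sub D (mCon F (ext C \<Gamma> T)) (mCon F \<Gamma>) S (mSub F (ext C \<Gamma> T) \<Gamma> (p_sub C \<Gamma> T))) \<phi> (ext_inv \<Gamma> T)"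

context
  fixes \<Delta> T S \<phi>
  assumes T: "\<Delta> \<in> Con C" "T \<in> Ty C \<Delta>" and S: "S \<in> Ty D (mCon F \<Delta>)"
    and \<phi>: "\<phi> \<in> Tm D (mCon F (ext C \<Delta> T))
      (ty_sub D (mCon F (ext C \<Delta> T)) (mCon F \<Delta>) S (mSub F (ext C \<Delta> T) \<Delta> (p_sub C \<Delta> T)))"
begin

lemma pull_closed:
  "pull \<Delta> T S \<phi> \<in> Tm D (ext D (mCon F \<Delta>) (mTy F \<Delta> T)) (ty_sub D (ext D (mCon F \<Delta>) (mTy F \<Delta> T))
      (mCon F \<Delta>) S
    (p_sub D (mCon F \<Delta>) (mTy F \<Delta> T)))"
  using T S \<phi> unfolding pull_def by (simp add: m_closed m_simps)

text \<open>By \<open>mSub_pair\<close>,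
  \<open>ext_inv \<circ> (id, F t) = F (id, t)\<close>.\<close>

lemma pull_app:
  "t \<in> Tm C \<Delta> T \<Longrightarrow> ty_app D (mCon F \<Delta>) (mTy F \<Delta> T) S (pull \<Delta> T S \<phi>) (mTm F \<Delta> T t)
    = tm_sub D (mCon F \<Delta>) (mCon F (ext C \<Delta> T))
      (ty_sub D (mCon F (ext C \<Delta> T)) (mCon F \<Delta>) S (mSub F (ext C \<Delta> T) \<Delta> (p_sub C \<Delta> T)))
      \<phi> (mSub F \<Delta> (ext C \<Delta> T) (sect C \<Delta> T t))"
  using T S \<phi> unfolding pull_def ty_app_def sect_def by (simp add: m_closed m_simps)

text \<open>Lifting commutes with the comparison: \<open>ext_inv \<circ> (F \<sigma> \<circ> p, q) =
  F (\<sigma> \<circ> p, q) \<circ> ext_inv\<close>. Naturality of a morphism thus reduces to the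
  behaviour of \<phi> under \<open>F\<close> of a lift.\<close>

lemma pull_reindex:
  "\<lbrakk>\<Gamma> \<in> Con C; \<sigma> \<in> Sub C \<Gamma> \<Delta>\<rbrakk> \<Longrightarrow> reindex D (mCon F \<Gamma>) (mCon F \<Delta>) (mTy F \<Delta> T) S (mSub F \<Gamma> \<Delta> \<sigma>)
      (pull \<Delta> T S \<phi>)
    = pull \<Gamma> (ty_sub C \<Gamma> \<Delta> T \<sigma>) (ty_sub D (mCon F \<Gamma>) (mCon F \<Delta>) S (mSub F \<Gamma> \<Delta> \<sigma>))
      (tm_sub D (mCon F (ext C \<Gamma> (ty_sub C \<Gamma> \<Delta> T \<sigma>))) (mCon F (ext C \<Delta> T))
        (ty_sub D (mCon F (ext C \<Delta> T)) (mCon F \<Delta>) S (mSub F (ext C \<Delta> T) \<Delta> (p_sub C \<Delta> T))) \<phi>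
        (mSub F (ext C \<Gamma> (ty_sub C \<Gamma> \<Delta> T \<sigma>)) (ext C \<Delta> T) (lift_sub C \<Gamma> \<Delta> T \<sigma>)))"
  using T S \<phi> unfolding pull_def reindex_def lift_sub_def Let_def by (simp add: m_closed m_simps)

end

end

section \<open>Dependent sums\<close>

context weak_flcwf_morphism
begin

text \<open>The same commutation of lifting with the comparison, applied to
  \<open>F B\<close>.\<close>

lemma mTy_ext_lift_ty:
  assumes "\<Gamma> \<in> Con C" "\<Delta> \<in> Con C" "A \<in> Ty C \<Delta>" "B \<in> Ty C (ext C \<Delta> A)" "\<sigma> \<in> Sub C \<Gamma> \<Delta>"
  shows "mTy_ext C D F \<Gamma> (ty_sub C \<Gamma> \<Delta> A \<sigma>) (C.lift_ty \<Gamma> \<Delta> A B \<sigma>)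
    = D.lift_ty (mCon F \<Gamma>) (mCon F \<Delta>) (mTy F \<Delta> A) (mTy_ext C D F \<Delta> A B) (mSub F \<Gamma> \<Delta> \<sigma>)"
  using assms by (simp add: m_closed m_simps C.lift_ty_def D.lift_ty_def lift_sub_def Let_def)

lemma mTy_ext_closed:
  "\<lbrakk>\<Gamma> \<in> Con C; A \<in> Ty C \<Gamma>; B \<in> Ty C (ext C \<Gamma> A)\<rbrakk>
    \<Longrightarrow> mTy_ext C D F \<Gamma> A B \<in> Ty D (ext D (mCon F \<Gamma>) (mTy F \<Gamma> A))"
  by (simp add: m_closed m_simps)

abbreviation "SigF \<Gamma> A B \<equiv> Sig D (mCon F \<Gamma>) (mTy F \<Gamma> A) (mTy_ext C D F \<Gamma> A B)"

section \<open>The natural map on terms of \<Sigma>-types\<close>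

text \<open>Taken over a substitution \<sigma> because the generic term \<open>q\<close> has type
  \<open>(Sig A B)[p]\<close>; \<open>A\<close> and \<open>B\<close> stay fixed, and naturality acts
  on \<sigma> and \<open>t\<close> alone.\<close>

definition map_Sig :: "'con1 \<Rightarrow> 'con1 \<Rightarrow> 'ty1 \<Rightarrow> 'ty1 \<Rightarrow> 'sub1 \<Rightarrow> 'tm1 \<Rightarrow> 'tm2" where
  "map_Sig \<Gamma> \<Delta> A B \<sigma> t =
    (let a = C.proj1_at \<Gamma> \<Delta> A B \<sigma> t; b = C.proj2_at \<Gamma> \<Delta> A B \<sigma> t
     in D.spair_at (mCon F \<Gamma>) (mCon F \<Delta>) (mTy F \<Delta> A) (mTy_ext C D F \<Delta> A B) (mSub F \<Gamma> \<Delta> \<sigma>)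
          (mTm F \<Gamma> (ty_sub C \<Gamma> \<Delta> A \<sigma>) a)
          (mTm F \<Gamma> (ty_sub C \<Gamma> (ext C \<Delta> A) B (pair_sub C \<Gamma> \<Delta> A \<sigma> a)) b))"

context
  fixes \<Gamma> \<Delta> A B \<sigma> t
  assumes base: "\<Gamma> \<in> Con C" "\<Delta> \<in> Con C" "A \<in> Ty C \<Delta>" "B \<in> Ty C (ext C \<Delta> A)" "\<sigma> \<in> Sub C \<Gamma> \<Delta>"
    and t: "t \<in> Tm C \<Gamma> (ty_sub C \<Gamma> \<Delta> (Sig C \<Delta> A B) \<sigma>)"
begin

lemma map_Sig_closed:
  "map_Sig \<Gamma> \<Delta> A B \<sigma> t \<in> Tm D (mCon F \<Gamma>) (ty_sub D (mCon F \<Gamma>) (mCon F \<Delta>) (SigF \<Delta> A B) (mSub F \<Gamma> \<Delta> \<sigma>))"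
  using base t by (simp add: map_Sig_def m_closed m_simps)

lemma map_Sig_subst:
  assumes "\<Theta> \<in> Con C" "\<delta> \<in> Sub C \<Theta> \<Gamma>"
  shows "tm_sub D (mCon F \<Theta>) (mCon F \<Gamma>) (ty_sub D (mCon F \<Gamma>) (mCon F \<Delta>) (SigF \<Delta> A B) (mSub F \<Gamma> \<Delta> \<sigma>))
      (map_Sig \<Gamma> \<Delta> A B \<sigma> t) (mSub F \<Theta> \<Gamma> \<delta>)
    = map_Sig \<Theta> \<Delta> A B (comp_sub C \<Theta> \<Gamma> \<Delta> \<sigma> \<delta>) (tm_sub C \<Theta> \<Gamma> (ty_sub C \<Gamma> \<Delta> (Sig C \<Delta> A B) \<sigma>) t \<delta>)"
  unfolding map_Sig_def
  using base t assms
    C.proj1_at_subst[OF base assms t refl, symmetric] C.proj2_at_subst[OF base assms t refl, symmetric]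
  by (simp add: m_closed m_simps)

end

lemma map_Sig_id:
  assumes "\<Gamma> \<in> Con C" "A \<in> Ty C \<Gamma>" "B \<in> Ty C (ext C \<Gamma> A)" "t \<in> Tm C \<Gamma> (Sig C \<Gamma> A B)"
  shows "map_Sig \<Gamma> \<Gamma> A B (id_sub C \<Gamma>) t
    = spair D (mCon F \<Gamma>) (mTy F \<Gamma> A) (mTy_ext C D F \<Gamma> A B) (mTm F \<Gamma> A (proj1 C \<Gamma> A B t))
     (mTm F \<Gamma> (ty_sub C \<Gamma> (ext C \<Gamma> A) B (sect C \<Gamma> A (proj1 C \<Gamma> A B t))) (proj2 C \<Gamma> A B t))"
  using assms
  by (simp add: map_Sig_def m_closed m_simps C.lift_ty_id D.lift_ty_id C.proj1_at_def C.proj2_at_def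
      D.spair_at_def sect_def)

text \<open>Relates the map built from substituted data, as it occurs in \<open>F_Sig\<close> on the
  right of the naturality equation, to the one built from the original data.\<close>

lemma map_Sig_lift_ty:
  assumes "\<Gamma> \<in> Con C" "\<Delta> \<in> Con C" "\<Theta> \<in> Con C" "A \<in> Ty C \<Theta>" "B \<in> Ty C (ext C \<Theta> A)"
    "\<sigma> \<in> Sub C \<Delta> \<Theta>" "\<delta> \<in> Sub C \<Gamma> \<Delta>"
    "t \<in> Tm C \<Gamma> (ty_sub C \<Gamma> \<Theta> (Sig C \<Theta> A B) (comp_sub C \<Gamma> \<Delta> \<Theta> \<sigma> \<delta>))"
  shows "map_Sig \<Gamma> \<Delta> (ty_sub C \<Delta> \<Theta> A \<sigma>) (C.lift_ty \<Delta> \<Theta> A B \<sigma>) \<delta> t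
    = map_Sig \<Gamma> \<Theta> A B (comp_sub C \<Gamma> \<Delta> \<Theta> \<sigma> \<delta>) t"
  using assms unfolding map_Sig_def Let_def
  by (simp add: C.proj1_at_lift_ty C.proj2_at_lift_ty C.lift_ty_pair D.spair_at_lift_ty
      mTy_ext_lift_ty mTy_ext_closed m_closed C.cwf_simps mTy_sub mSub_comp)

definition F_Sig :: "'con1 \<Rightarrow> 'ty1 \<Rightarrow> 'ty1 \<Rightarrow> 'tm2" where
  "F_Sig \<Gamma> A B = (let T = Sig C \<Gamma> A B
    in pull \<Gamma> T (SigF \<Gamma> A B) (map_Sig (ext C \<Gamma> T) \<Gamma> A B (p_sub C \<Gamma> T) (q_tm C \<Gamma> T)))"

lemma SigF_closed:
  "\<lbrakk>\<Gamma> \<in> Con C; A \<in> Ty C \<Gamma>; B \<in> Ty C (ext C \<Gamma> A)\<rbrakk> \<Longrightarrow> SigF \<Gamma> A B \<in> Ty D (mCon F \<Gamma>)"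
  by (simp add: m_closed m_simps)

text \<open>After \<open>pull_app\<close>, naturality specializes the generic map along
  \<open>(id, t)\<close>, where \<open>p\<close> becomes \<open>id\<close> and \<open>q\<close>
  becomes \<open>t\<close>.\<close>

lemma F_Sig_app:
  assumes "\<Gamma> \<in> Con C" "A \<in> Ty C \<Gamma>" "B \<in> Ty C (ext C \<Gamma> A)" "t \<in> Tm C \<Gamma> (Sig C \<Gamma> A B)"
  shows "ty_app D (mCon F \<Gamma>) (mTy F \<Gamma> (Sig C \<Gamma> A B)) (SigF \<Gamma> A B) (F_Sig \<Gamma> A B) (mTm F \<Gamma> (Sig C \<Gamma> A B) t)
    = map_Sig \<Gamma> \<Gamma> A B (id_sub C \<Gamma>) t"
  unfolding F_Sig_def Let_def using assms
  by (simp add: pull_app m_closed C.cwf_simps SigF_closed map_Sig_closed map_Sig_subst sect_def)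

text \<open>After \<open>pull_reindex\<close>, naturality specializes the generic map along
  \<open>(\<sigma> \<circ> p, q)\<close>: \<open>p\<close> becomes
  \<open>\<sigma> \<circ> p\<close>, and \<open>q\<close> becomes the generic term of the
  substituted type.\<close>

lemma F_Sig_reindex:
  assumes "\<Gamma> \<in> Con C" "\<Delta> \<in> Con C" "A \<in> Ty C \<Delta>" "B \<in> Ty C (ext C \<Delta> A)" "\<sigma> \<in> Sub C \<Gamma> \<Delta>"
  shows "reindex D (mCon F \<Gamma>) (mCon F \<Delta>) (mTy F \<Delta> (Sig C \<Delta> A B)) (SigF \<Delta> A B) (mSub F \<Gamma> \<Delta> \<sigma>)
      (F_Sig \<Delta> A B)
     = F_Sig \<Gamma> (ty_sub C \<Gamma> \<Delta> A \<sigma>) (C.lift_ty \<Gamma> \<Delta> A B \<sigma>)"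
proof -
  let ?A = "ty_sub C \<Gamma> \<Delta> A \<sigma>" and ?B = "C.lift_ty \<Gamma> \<Delta> A B \<sigma>"
  let ?T = "ty_sub C \<Gamma> \<Delta> (Sig C \<Delta> A B) \<sigma>"
  let ?p = "p_sub C \<Gamma> ?T" and ?q = "q_tm C \<Gamma> ?T" and ?\<Gamma> = "ext C \<Gamma> ?T"
  have T: "?T = Sig C \<Gamma> ?A ?B"
    using assms by (rule C.Sig_lift_ty)
  have S: "ty_sub D (mCon F \<Gamma>) (mCon F \<Delta>) (SigF \<Delta> A B) (mSub F \<Gamma> \<Delta> \<sigma>) = SigF \<Gamma> ?A ?B"
    using assms by (simp add: D.Sig_lift_ty mTy_ext_lift_ty mTy_ext_closed m_closed mTy_sub)
  have at: "map_Sig ?\<Gamma> \<Gamma> ?A ?B ?p ?q = map_Sig ?\<Gamma> \<Delta> A B (comp_sub C ?\<Gamma> \<Gamma> \<Delta> \<sigma> ?p) ?q"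
    using assms by (intro map_Sig_lift_ty) (simp_all add: C.fl_closed C.cwf_simps)
  show ?thesis
    unfolding F_Sig_def Let_def T[symmetric] S[symmetric] at using assms
    by (simp add: pull_reindex m_closed C.cwf_simps SigF_closed map_Sig_closed map_Sig_subst lift_sub_def Let_def)
qed

section \<open>The inverse for \<Sigma>-types\<close>

text \<open>The substitution \<open>(\<tau>, proj1 s, proj2 s)\<close>, corrected by two comparison
  inverses. \<open>X\<close> is any context of \<open>D\<close>, since the inverse morphism lives
  over \<open>F \<Gamma> \<triangleright> S\<close>, which need not be in the image of
  \<open>F\<close>.\<close>

definition unpair :: "'con2 \<Rightarrow> 'con1 \<Rightarrow> 'ty1 \<Rightarrow> 'ty1 \<Rightarrow> 'sub2 \<Rightarrow> 'tm2 \<Rightarrow> 'sub2" where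
  "unpair X \<Gamma> A B \<tau> s =
    (let FA = mTy F \<Gamma> A; FB = mTy F (ext C \<Gamma> A) B; B' = mTy_ext C D F \<Gamma> A B
     in comp_sub D X (ext D (mCon F (ext C \<Gamma> A)) FB) (mCon F (ext C (ext C \<Gamma> A) B)) (ext_inv
         (ext C \<Gamma> A) B)
          (pair_sub D X (mCon F (ext C \<Gamma> A)) FB
            (comp_sub D X (ext D (mCon F \<Gamma>) FA) (mCon F (ext C \<Gamma> A)) (ext_inv \<Gamma> A)
              (pair_sub D X (mCon F \<Gamma>) FA \<tau> (D.proj1_at X (mCon F \<Gamma>) FA B' \<tau> s)))
            (D.proj2_at X (mCon F \<Gamma>) FA B' \<tau> s)))"

context
  fixes \<Gamma> A B
  assumes \<Gamma>: "\<Gamma> \<in> Con C" "A \<in> Ty C \<Gamma>" "B \<in> Ty C (ext C \<Gamma> A)"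
begin

context
  fixes X \<tau> s
  assumes X: "X \<in> Con D" "\<tau> \<in> Sub D X (mCon F \<Gamma>)"
    and s: "s \<in> Tm D X (ty_sub D X (mCon F \<Gamma>) (SigF \<Gamma> A B) \<tau>)"
begin

lemma unpair_closed: "unpair X \<Gamma> A B \<tau> s \<in> Sub D X (mCon F (ext C (ext C \<Gamma> A) B))"
  using \<Gamma> X s by (simp add: unpair_def m_closed m_simps)

lemma unpair_comp:
  assumes "Y \<in> Con D" "\<delta> \<in> Sub D Y X"
  shows "comp_sub D Y X (mCon F (ext C (ext C \<Gamma> A) B)) (unpair X \<Gamma> A B \<tau> s) \<delta>
    = unpair Y \<Gamma> A B (comp_sub D Y X (mCon F \<Gamma>) \<tau> \<delta>)
        (tm_sub D Y X (ty_sub D X (mCon F \<Gamma>) (SigF \<Gamma> A B) \<tau>) s \<delta>)"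
  using \<Gamma> X s assms by (simp add: unpair_def m_closed m_simps D.proj1_at_subst D.proj2_at_subst)

end

text \<open>The universal pair: each term of a substituted \<open>Sig A B\<close> is the instance of
  \<open>gen_pair\<close> along its two projections.\<close>

definition "gen_ctx = ext C (ext C \<Gamma> A) B"

definition "gen_p = comp_sub C gen_ctx (ext C \<Gamma> A) \<Gamma> (p_sub C \<Gamma> A) (p_sub C (ext C \<Gamma> A) B)"

definition "gen_pair = C.spair_at gen_ctx \<Gamma> A B gen_p
  (tm_sub C gen_ctx (ext C \<Gamma> A) (ty_sub C (ext C \<Gamma> A) \<Gamma> A (p_sub C \<Gamma> A)) (q_tm C \<Gamma> A) (p_sub C
      (ext C \<Gamma> A) B))
  (q_tm C (ext C \<Gamma> A) B)"

lemmas gen_defs = gen_ctx_def gen_p_def gen_pair_def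

lemma gen_p_closed: "gen_p \<in> Sub C gen_ctx \<Gamma>"
  using \<Gamma> by (simp add: gen_defs C.fl_closed C.fl_simps)

lemma gen_pair_closed: "gen_pair \<in> Tm C gen_ctx (ty_sub C gen_ctx \<Gamma> (Sig C \<Gamma> A B) gen_p)"
  using \<Gamma> by (simp add: gen_defs C.fl_closed C.fl_simps)

text \<open>The projections of \<open>D\<close> cancel the pairing inside \<open>map_Sig\<close>,
  and \<open>mSub_pair\<close> is then read backwards twice.\<close>

lemma unpair_map_Sig:
  assumes "\<Delta> \<in> Con C" "\<sigma> \<in> Sub C \<Delta> \<Gamma>" "t \<in> Tm C \<Delta> (ty_sub C \<Delta> \<Gamma> (Sig C \<Gamma> A B) \<sigma>)"
  defines "a \<equiv> C.proj1_at \<Delta> \<Gamma> A B \<sigma> t" and "b \<equiv> C.proj2_at \<Delta> \<Gamma> A B \<sigma> t"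
  shows "unpair (mCon F \<Delta>) \<Gamma> A B (mSub F \<Delta> \<Gamma> \<sigma>) (map_Sig \<Delta> \<Gamma> A B \<sigma> t)
    = mSub F \<Delta> gen_ctx (pair_sub C \<Delta> (ext C \<Gamma> A) B (pair_sub C \<Delta> \<Gamma> A \<sigma> a) b)"
  using \<Gamma> assms(1-3) unfolding a_def b_def gen_ctx_def
  by (simp add: unpair_def map_Sig_def m_closed m_simps)

text \<open>Each comparison inverse is peeled off by \<open>p_ext_inv\<close> and
  \<open>q_ext_inv\<close>. The two generic components become \<open>proj1 s\<close> and
  \<open>proj2 s\<close>, and eta in \<open>D\<close> gives \<open>s\<close>.\<close>

lemma unpair_gen:
  assumes "X \<in> Con D" "\<tau> \<in> Sub D X (mCon F \<Gamma>)"
    "s \<in> Tm D X (ty_sub D X (mCon F \<Gamma>) (SigF \<Gamma> A B) \<tau>)"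
  shows unpair_p: "comp_sub D X (mCon F gen_ctx) (mCon F \<Gamma>) (mSub F gen_ctx \<Gamma> gen_p)
      (unpair X \<Gamma> A B \<tau> s) = \<tau>"
    and unpair_gen_pair: "tm_sub D X (mCon F gen_ctx)
      (ty_sub D (mCon F gen_ctx) (mCon F \<Gamma>) (SigF \<Gamma> A B) (mSub F gen_ctx \<Gamma> gen_p))
      (map_Sig gen_ctx \<Gamma> A B gen_p gen_pair) (unpair X \<Gamma> A B \<tau> s) = s"
  using \<Gamma> assms by (simp_all add: gen_defs map_Sig_def unpair_def m_closed m_simps)

lemma F_Sig_iso:
  "ty_iso D (mCon F \<Gamma>) (mTy F \<Gamma> (Sig C \<Gamma> A B)) (SigF \<Gamma> A B) (F_Sig \<Gamma> A B)"
proof -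
  let ?T = "Sig C \<Gamma> A B" and ?S = "SigF \<Gamma> A B"
  let ?FT = "mTy F \<Gamma> ?T"
  let ?X = "ext D (mCon F \<Gamma>) ?FT" and ?Y = "ext D (mCon F \<Gamma>) ?S" and ?\<Gamma> = "ext C \<Gamma> ?T"
  let ?pY = "p_sub D (mCon F \<Gamma>) ?S" and ?pX = "p_sub D (mCon F \<Gamma>) ?FT"
  \<comment> \<open>\<theta> unpairs the generic term of
    \<open>F \<Gamma> \<triangleright> S\<close>; the inverse \<open>?u\<close> is
    \<open>F gen_pair\<close> pulled back along it.\<close>
  let ?\<theta> = "unpair ?Y \<Gamma> A B ?pY (q_tm D (mCon F \<Gamma>) ?S)"
  let ?P = "ty_sub C gen_ctx \<Gamma> ?T gen_p"
  let ?u = "tm_sub D ?Y (mCon F gen_ctx) (mTy F gen_ctx ?P) (mTm F gen_ctx ?P gen_pair) ?\<theta>"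
  let ?m = "map_Sig ?\<Gamma> \<Gamma> A B (p_sub C \<Gamma> ?T) (q_tm C \<Gamma> ?T)"
  let ?SP = "ty_sub D (mCon F ?\<Gamma>) (mCon F \<Gamma>) ?S (mSub F ?\<Gamma> \<Gamma> (p_sub C \<Gamma> ?T))"
  note closed = SigF_closed[OF \<Gamma>] gen_p_closed gen_pair_closed
  have T: "?T \<in> Ty C \<Gamma>" "?\<Gamma> \<in> Con C" "p_sub C \<Gamma> ?T \<in> Sub C ?\<Gamma> \<Gamma>"
    "q_tm C \<Gamma> ?T \<in> Tm C ?\<Gamma> (ty_sub C ?\<Gamma> \<Gamma> ?T (p_sub C \<Gamma> ?T))" "gen_ctx \<in> Con C"
    using \<Gamma> by (simp_all add: gen_ctx_def C.fl_closed)
  have m: "?m \<in> Tm D (mCon F ?\<Gamma>) ?SP"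
    using \<Gamma> T by (simp add: map_Sig_closed)
  have Y: "?Y \<in> Con D" "?pY \<in> Sub D ?Y (mCon F \<Gamma>)"
    "q_tm D (mCon F \<Gamma>) ?S \<in> Tm D ?Y (ty_sub D ?Y (mCon F \<Gamma>) ?S ?pY)"
    using \<Gamma> T closed by (simp_all add: m_closed)
  have X: "?X \<in> Con D" "?pX \<in> Sub D ?X (mCon F \<Gamma>)" "?FT \<in> Ty D (mCon F \<Gamma>)" "mCon F \<Gamma> \<in> Con D"
    using \<Gamma> T closed by (simp_all add: m_closed)
  have \<theta>: "?\<theta> \<in> Sub D ?Y (mCon F gen_ctx)"
    unfolding gen_ctx_def by (rule unpair_closed[OF Y])
  have p\<theta>: "comp_sub D ?Y (mCon F gen_ctx) (mCon F \<Gamma>) (mSub F gen_ctx \<Gamma> gen_p) ?\<theta> = ?pY"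
    by (rule unpair_p[OF Y])
  \<comment> \<open>\<open>?r\<close> goes from
    \<open>\<Gamma> \<triangleright> A \<triangleright> B\<close> to
    \<open>\<Gamma> \<triangleright> Sig A B\<close> and classifies the generic pair.\<close>
  let ?r = "pair_sub C gen_ctx \<Gamma> ?T gen_p gen_pair"
  have r_closed: "?r \<in> Sub C gen_ctx ?\<Gamma>"
    using \<Gamma> T closed by (simp add: m_closed)
  have F\<Gamma>: "mCon F ?\<Gamma> \<in> Con D" "mCon F gen_ctx \<in> Con D" "?SP \<in> Ty D (mCon F ?\<Gamma>)"
    "ext_inv \<Gamma> ?T \<in> Sub D ?X (mCon F ?\<Gamma>)" "mSub F gen_ctx ?\<Gamma> ?r \<in> Sub D (mCon F gen_ctx) (mCon F ?\<Gamma>)"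
    using \<Gamma> T X closed r_closed by (simp_all add: m_closed)
  have P: "mTy F gen_ctx ?P \<in> Ty D (mCon F gen_ctx)" "mTm F gen_ctx ?P gen_pair \<in> Tm D
      (mCon F gen_ctx) (mTy F gen_ctx ?P)"
    using \<Gamma> T closed by (simp_all add: m_closed)
  have YP: "ty_sub D ?Y (mCon F \<Gamma>) ?FT ?pY = ty_sub D ?Y (mCon F gen_ctx) (mTy F gen_ctx ?P) ?\<theta>"
    using \<Gamma> T Y X \<theta> p\<theta> closed by (simp add: m_closed D.cwf_simps mTy_sub)
  have u: "?u \<in> Tm D ?Y (ty_sub D ?Y (mCon F \<Gamma>) ?FT ?pY)"
    unfolding YP by (rule D.tm_sub_closed[OF Y(1) F\<Gamma>(2) P \<theta>])
  let ?f = "pull \<Gamma> ?T ?S ?m"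
  have f: "F_Sig \<Gamma> A B = ?f"
    by (simp add: F_Sig_def Let_def)
  have f_closed: "?f \<in> Tm D ?X (ty_sub D ?X (mCon F \<Gamma>) ?S ?pX)"
    using pull_closed[OF \<Gamma>(1) T(1) closed(1) m] .
  \<comment> \<open>Composing with \<open>?u\<close> evaluates \<open>?m\<close> along
    \<open>ext_inv \<circ> (p, u)\<close>. As this is \<open>F r \<circ> \<theta>\<close>, only
    \<open>map_Sig\<close> at the generic pair has to be computed.\<close>
  have r: "comp_sub D ?Y (mCon F gen_ctx) (mCon F ?\<Gamma>) (mSub F gen_ctx ?\<Gamma> ?r) ?\<theta>
    = comp_sub D ?Y ?X (mCon F ?\<Gamma>) (ext_inv \<Gamma> ?T) (pair_sub D ?Y (mCon F \<Gamma>) ?FT ?pY ?u)"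
    using \<Gamma> T Y X \<theta> p\<theta> closed by (simp add: m_closed D.cwf_simps mSub_pair mTy_sub)
  have mr: "tm_sub D (mCon F gen_ctx) (mCon F ?\<Gamma>) ?SP ?m (mSub F gen_ctx ?\<Gamma> ?r)
    = map_Sig gen_ctx \<Gamma> A B gen_p gen_pair"
    using \<Gamma> T closed r_closed by (simp add: map_Sig_subst C.cwf_simps)
  have k: "pair_sub D ?Y (mCon F \<Gamma>) ?FT ?pY ?u \<in> Sub D ?Y ?X"
    by (rule D.pair_sub_closed[OF Y(1) X(4) X(3) Y(2) u])
  have pk: "comp_sub D ?Y ?X (mCon F \<Gamma>) ?pX (pair_sub D ?Y (mCon F \<Gamma>) ?FT ?pY ?u) = ?pY"
    by (rule D.p_sub_beta[OF Y(1) X(4) X(3) Y(2) u])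
  have SX: "ty_sub D ?X (mCon F \<Gamma>) ?S ?pX = ty_sub D ?X (mCon F ?\<Gamma>) ?SP (ext_inv \<Gamma> ?T)"
    using \<Gamma> T X closed by (simp add: m_closed D.cwf_simps p_ext_inv)
  have fu: "tm_sub D ?Y ?X (ty_sub D ?X (mCon F \<Gamma>) ?S ?pX) ?f
      (pair_sub D ?Y (mCon F \<Gamma>) ?FT ?pY ?u) = q_tm D (mCon F \<Gamma>) ?S"
  proof -
    have "tm_sub D ?Y ?X (ty_sub D ?X (mCon F \<Gamma>) ?S ?pX) ?f (pair_sub D ?Y (mCon F \<Gamma>) ?FT ?pY ?u)
      = tm_sub D ?Y (mCon F ?\<Gamma>) ?SP ?m
        (comp_sub D ?Y (mCon F gen_ctx) (mCon F ?\<Gamma>) (mSub F gen_ctx ?\<Gamma> ?r) ?\<theta>)"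
      unfolding r pull_def
      by (rule D.tm_sub_tm_sub[OF Y(1) X(1) F\<Gamma>(1,3) m k F\<Gamma>(4) SX])
    also have "\<dots> = tm_sub D ?Y (mCon F gen_ctx)
        (ty_sub D (mCon F gen_ctx) (mCon F ?\<Gamma>) ?SP (mSub F gen_ctx ?\<Gamma> ?r))
        (map_Sig gen_ctx \<Gamma> A B gen_p gen_pair) ?\<theta>"
      unfolding mr[symmetric]
      by (rule D.tm_sub_comp[OF Y(1) F\<Gamma>(2,1,3) m \<theta> F\<Gamma>(5)])
    also have "\<dots> = q_tm D (mCon F \<Gamma>) ?S"
      using unpair_gen_pair[OF Y] \<Gamma> T closed r_closed
      by (simp add: m_closed D.cwf_simps mSub_comp[symmetric] C.cwf_simps)
    finally show ?thesis .
  qed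
  \<comment> \<open>The opposite direction: the generic term of
    \<open>\<Gamma> \<triangleright> Sig A B\<close> split into its projections. By eta,
    \<open>gen_pair\<close> becomes \<open>q\<close> along it.\<close>
  let ?\<rho> = "pair_sub C ?\<Gamma> (ext C \<Gamma> A) B (pair_sub C ?\<Gamma> \<Gamma> A (p_sub C \<Gamma> ?T)
    (C.proj1_at ?\<Gamma> \<Gamma> A B (p_sub C \<Gamma> ?T) (q_tm C \<Gamma> ?T)))
    (C.proj2_at ?\<Gamma> \<Gamma> A B (p_sub C \<Gamma> ?T) (q_tm C \<Gamma> ?T))"
  have \<rho>: "?\<rho> \<in> Sub C ?\<Gamma> gen_ctx" "comp_sub C ?\<Gamma> gen_ctx \<Gamma> gen_p ?\<rho> = p_sub C \<Gamma> ?T"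
    "tm_sub C ?\<Gamma> gen_ctx ?P gen_pair ?\<rho> = q_tm C \<Gamma> ?T"
    using \<Gamma> T by (simp_all add: gen_defs C.fl_closed C.fl_simps)
  have uf: "tm_sub D ?X ?Y (ty_sub D ?Y (mCon F \<Gamma>) ?FT ?pY) ?u
      (pair_sub D ?X (mCon F \<Gamma>) ?S ?pX ?f) = q_tm D (mCon F \<Gamma>) ?FT"
  proof -
    let ?k = "pair_sub D ?X (mCon F \<Gamma>) ?S ?pX ?f"
    have k: "?k \<in> Sub D ?X ?Y"
      by (rule D.pair_sub_closed[OF X(1,4) closed(1) X(2) f_closed])
    \<comment> \<open>Naturality of \<open>unpair\<close> is used twice: to replace the generic term
      by \<open>?f\<close>, then to extract \<open>ext_inv\<close>. What remains is
      \<open>unpair\<close> of a \<open>map_Sig\<close>, which is \<open>F\<close> of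
      \<open>?\<rho>\<close>.\<close>
    have "comp_sub D ?X ?Y (mCon F gen_ctx) ?\<theta> ?k = unpair ?X \<Gamma> A B ?pX ?f"
      unfolding gen_ctx_def
      by (simp only: unpair_comp[OF Y X(1) k] D.p_sub_beta[OF X(1,4) closed(1) X(2) f_closed]
          D.q_tm_beta[OF X(1,4) closed(1) X(2) f_closed])
    also have "\<dots> = comp_sub D ?X (mCon F ?\<Gamma>) (mCon F gen_ctx)
        (unpair (mCon F ?\<Gamma>) \<Gamma> A B (mSub F ?\<Gamma> \<Gamma> (p_sub C \<Gamma> ?T)) ?m) (ext_inv \<Gamma> ?T)"
      unfolding gen_ctx_def pull_def
      by (simp only: unpair_comp[OF F\<Gamma>(1) mSub_closed[OF T(2) \<Gamma>(1) T(3)] m X(1) F\<Gamma>(4)]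
          p_ext_inv[OF \<Gamma>(1) T(1) refl])
    also have "\<dots> = comp_sub D ?X (mCon F ?\<Gamma>) (mCon F gen_ctx) (mSub F ?\<Gamma> gen_ctx ?\<rho>) (ext_inv \<Gamma> ?T)"
      by (simp only: unpair_map_Sig[OF T(2,3,4)])
    finally have \<theta>k: "comp_sub D ?X ?Y (mCon F gen_ctx) ?\<theta> ?k
      = comp_sub D ?X (mCon F ?\<Gamma>) (mCon F gen_ctx) (mSub F ?\<Gamma> gen_ctx ?\<rho>) (ext_inv \<Gamma> ?T)" .
    have "tm_sub D ?X ?Y (ty_sub D ?Y (mCon F \<Gamma>) ?FT ?pY) ?u ?k
      = tm_sub D ?X (mCon F gen_ctx) (mTy F gen_ctx ?P) (mTm F gen_ctx ?P gen_pair)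
         (comp_sub D ?X ?Y (mCon F gen_ctx) ?\<theta> ?k)"
      by (rule D.tm_sub_tm_sub[OF X(1) Y(1) F\<Gamma>(2) P k \<theta> YP])
    also have "\<dots> = tm_sub D ?X (mCon F ?\<Gamma>) (mTy F ?\<Gamma> (ty_sub C ?\<Gamma> gen_ctx ?P ?\<rho>))
        (mTm F ?\<Gamma> (ty_sub C ?\<Gamma> gen_ctx ?P ?\<rho>) (tm_sub C ?\<Gamma> gen_ctx ?P gen_pair ?\<rho>)) (ext_inv \<Gamma> ?T)"
      unfolding \<theta>k using \<Gamma> T X closed \<rho>(1)
      by (simp add: D.tm_sub_comp mTm_sub mTy_sub[symmetric] m_closed)
    also have "\<dots> = q_tm D (mCon F \<Gamma>) ?FT"
      unfolding \<rho>(3) using \<Gamma> T closed \<rho>(1,2) by (intro q_ext_inv) (simp_all add: C.cwf_simps)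
    finally show ?thesis .
  qed
  show ?thesis
    unfolding f using X Y closed f_closed u fu uf by (intro D.ty_isoI) simp_all
qed

end

text \<open>The beta laws of \<open>D\<close> apply once \<open>F\<close> of the second projection
  is well typed, that is, once \<open>F (B[id, a])\<close> is
  \<open>(mTy_ext A B)[id, F a]\<close>.\<close>

lemma map_Sig_beta:
  assumes "\<Gamma> \<in> Con C" "A \<in> Ty C \<Gamma>" "B \<in> Ty C (ext C \<Gamma> A)" "t \<in> Tm C \<Gamma> (Sig C \<Gamma> A B)"
  shows "proj1 D (mCon F \<Gamma>) (mTy F \<Gamma> A) (mTy_ext C D F \<Gamma> A B) (map_Sig \<Gamma> \<Gamma> A B (id_sub C \<Gamma>) t)
      = mTm F \<Gamma> A (proj1 C \<Gamma> A B t)" (is ?p1)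
    and "proj2 D (mCon F \<Gamma>) (mTy F \<Gamma> A) (mTy_ext C D F \<Gamma> A B) (map_Sig \<Gamma> \<Gamma> A B (id_sub C \<Gamma>) t)
      = mTm F \<Gamma> (ty_sub C \<Gamma> (ext C \<Gamma> A) B (sect C \<Gamma> A (proj1 C \<Gamma> A B t))) (proj2 C \<Gamma> A B t)" (is ?p2)
proof -
  let ?a = "proj1 C \<Gamma> A B t"
  have a: "?a \<in> Tm C \<Gamma> A"
    using assms by (rule C.proj1_closed)
  have s: "sect C \<Gamma> A ?a \<in> Sub C \<Gamma> (ext C \<Gamma> A)"
    using assms a by (simp add: sect_def C.cwf_closed C.cwf_simps)
  have "mTy F \<Gamma> (ty_sub C \<Gamma> (ext C \<Gamma> A) B (sect C \<Gamma> A ?a))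
    = ty_sub D (mCon F \<Gamma>) (ext D (mCon F \<Gamma>) (mTy F \<Gamma> A)) (mTy_ext C D F \<Gamma> A B)
        (sect D (mCon F \<Gamma>) (mTy F \<Gamma> A) (mTm F \<Gamma> A ?a))"
    using assms a by (simp add: m_closed m_simps sect_def)
  then have b: "mTm F \<Gamma> (ty_sub C \<Gamma> (ext C \<Gamma> A) B (sect C \<Gamma> A ?a)) (proj2 C \<Gamma> A B t)
    \<in> Tm D (mCon F \<Gamma>) (ty_sub D (mCon F \<Gamma>) (ext D (mCon F \<Gamma>) (mTy F \<Gamma> A)) (mTy_ext C D F \<Gamma> A B)
        (sect D (mCon F \<Gamma>) (mTy F \<Gamma> A) (mTm F \<Gamma> A ?a)))"
    using mTm_closed[OF assms(1) C.ty_sub_closed[OF assms(1) C.ext_closed[OF assms(1,2)] assms(3) s]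
        C.proj2_closed[OF assms]] by simp
  show ?p1
    unfolding map_Sig_id[OF assms] using assms a b
    by (simp add: D.proj1_beta mTy_ext_closed mCon_closed mTy_closed mTm_closed)
  show ?p2
    unfolding map_Sig_id[OF assms] using assms a b
    by (simp add: D.proj2_beta mTy_ext_closed mCon_closed mTy_closed mTm_closed)
qed

end

section \<open>Constant families\<close>

context weak_flcwf_morphism
begin

text \<open>The retraction factors the identity of \<open>F \<bullet>\<close> through the empty
  context, so every substitution into \<open>F \<bullet>\<close> equals
  \<open>\<rho> \<circ> eps\<close>.\<close>

lemma F_emp_unique:
  assumes X: "X \<in> Con D" and "\<sigma> \<in> Sub D X (mCon F (emp C))" "\<tau> \<in> Sub D X (mCon F (emp C))"
  shows "\<sigma> = \<tau>"
proof -
  let ?Z = "mCon F (emp C)"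
  have Z: "?Z \<in> Con D" "emp D \<in> Con D" "eps D ?Z \<in> Sub D ?Z (emp D)"
    by (simp_all add: m_closed)
  obtain \<rho> where \<rho>: "\<rho> \<in> Sub D (emp D) ?Z"
    "comp_sub D ?Z (emp D) ?Z \<rho> (eps D ?Z) = id_sub D ?Z"
    using emp_retraction by blast
  have "\<upsilon> = comp_sub D X (emp D) ?Z \<rho> (eps D X)" if \<upsilon>: "\<upsilon> \<in> Sub D X ?Z" for \<upsilon>
  proof -
    have "\<upsilon> = comp_sub D X ?Z ?Z (comp_sub D ?Z (emp D) ?Z \<rho> (eps D ?Z)) \<upsilon>"
      unfolding \<rho>(2) by (rule D.comp_id_left[OF X Z(1) \<upsilon>, symmetric])
    also have "\<dots> = comp_sub D X (emp D) ?Z \<rho> (comp_sub D X ?Z (emp D) (eps D ?Z) \<upsilon>)"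
      by (rule D.comp_assoc[OF X Z(1,2,1) \<upsilon> Z(3) \<rho>(1)])
    also have "comp_sub D X ?Z (emp D) (eps D ?Z) \<upsilon> = eps D X"
      by (rule D.eps_unique[OF X D.comp_closed[OF X Z(1,2) \<upsilon> Z(3)]])
    finally show ?thesis .
  qed
  with assms(2,3) show ?thesis by metis
qed

lemma mTy_K_emp:
  assumes "\<Gamma> \<in> Con C" "\<Theta> \<in> Con C"
  shows "mTy F \<Gamma> (K C \<Gamma> \<Theta>)
    = ty_sub D (mCon F \<Gamma>) (mCon F (emp C)) (mTy F (emp C) (K C (emp C) \<Theta>)) (mSub F \<Gamma> (emp C) (eps C \<Gamma>))"
  using assms mTy_sub[of \<Gamma> "emp C" "K C (emp C) \<Theta>" "eps C \<Gamma>"] by (simp add: C.fl_closed C.fl_simps)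

text \<open>Both types are pulled back from \<open>F \<bullet>\<close>, and substitutions into
  \<open>F \<bullet>\<close> are unique. This is what makes the inverse for \<open>K\<close> well
  typed.\<close>

lemma mTy_K_const:
  assumes "\<Gamma> \<in> Con C" "\<Delta> \<in> Con C" "\<Theta> \<in> Con C" "X \<in> Con D" "\<sigma> \<in> Sub D X (mCon F \<Gamma>)" "\<tau> \<in> Sub D X
      (mCon F \<Delta>)"
  shows "ty_sub D X (mCon F \<Gamma>) (mTy F \<Gamma> (K C \<Gamma> \<Theta>)) \<sigma> = ty_sub D X (mCon F \<Delta>) (mTy F \<Delta> (K C \<Delta> \<Theta>)) \<tau>"
proof -
  let ?Z = "emp C"
  have "comp_sub D X (mCon F \<Gamma>) (mCon F ?Z) (mSub F \<Gamma> ?Z (eps C \<Gamma>)) \<sigma>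
    = comp_sub D X (mCon F \<Delta>) (mCon F ?Z) (mSub F \<Delta> ?Z (eps C \<Delta>)) \<tau>"
    using assms by (intro F_emp_unique[OF assms(4)]) (simp_all add: m_closed)
  then show ?thesis
    using assms by (simp add: mTy_K_emp[of \<Gamma>] mTy_K_emp[of \<Delta>] m_closed D.cwf_simps)
qed

definition map_K :: "'con1 \<Rightarrow> 'con1 \<Rightarrow> 'tm1 \<Rightarrow> 'tm2" where
  "map_K \<Gamma> \<Delta> t = lamK D (mCon F \<Gamma>) (mCon F \<Delta>) (mSub F \<Gamma> \<Delta> (appK C \<Gamma> \<Delta> t))"

lemma map_K_closed:
  "\<lbrakk>\<Gamma> \<in> Con C; \<Delta> \<in> Con C; t \<in> Tm C \<Gamma> (K C \<Gamma> \<Delta>); X = K D (mCon F \<Gamma>) (mCon F \<Delta>)\<rbrakk>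
    \<Longrightarrow> map_K \<Gamma> \<Delta> t \<in> Tm D (mCon F \<Gamma>) X"
  by (simp add: map_K_def m_closed)

lemma map_K_subst:
  "\<lbrakk>\<Gamma> \<in> Con C; \<Delta> \<in> Con C; \<Theta> \<in> Con C; \<sigma> \<in> Sub C \<Gamma> \<Delta>; t \<in> Tm C \<Delta> (K C \<Delta> \<Theta>)\<rbrakk>
    \<Longrightarrow> tm_sub D (mCon F \<Gamma>) (mCon F \<Delta>) (K D (mCon F \<Delta>) (mCon F \<Theta>)) (map_K \<Delta> \<Theta> t) (mSub F \<Gamma> \<Delta> \<sigma>)
      = map_K \<Gamma> \<Theta> (tm_sub C \<Gamma> \<Delta> (K C \<Delta> \<Theta>) t \<sigma>)"
  by (simp add: map_K_def C.appK_subst D.lamK_sub m_closed mSub_comp)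

definition F_K :: "'con1 \<Rightarrow> 'con1 \<Rightarrow> 'tm2" where
  "F_K \<Gamma> \<Delta> = pull \<Gamma> (K C \<Gamma> \<Delta>) (K D (mCon F \<Gamma>) (mCon F \<Delta>))
     (map_K (ext C \<Gamma> (K C \<Gamma> \<Delta>)) \<Delta> (q_tm C \<Gamma> (K C \<Gamma> \<Delta>)))"

lemma map_K_q:
  assumes "\<Gamma> \<in> Con C" "\<Delta> \<in> Con C"
  shows "map_K (ext C \<Gamma> (K C \<Gamma> \<Delta>)) \<Delta> (q_tm C \<Gamma> (K C \<Gamma> \<Delta>)) \<in> Tm D (mCon F (ext C \<Gamma> (K C \<Gamma> \<Delta>)))
      (ty_sub D (mCon F (ext C \<Gamma> (K C \<Gamma> \<Delta>))) (mCon F \<Gamma>) (K D (mCon F \<Gamma>) (mCon F \<Delta>))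
        (mSub F (ext C \<Gamma> (K C \<Gamma> \<Delta>)) \<Gamma> (p_sub C \<Gamma> (K C \<Gamma> \<Delta>))))"
  using assms by (simp add: map_K_closed m_closed C.K_sub D.K_sub)

lemma F_K_app:
  assumes "\<Gamma> \<in> Con C" "\<Delta> \<in> Con C" "t \<in> Tm C \<Gamma> (K C \<Gamma> \<Delta>)"
  shows "ty_app D (mCon F \<Gamma>) (mTy F \<Gamma> (K C \<Gamma> \<Delta>)) (K D (mCon F \<Gamma>) (mCon F \<Delta>)) (F_K \<Gamma> \<Delta>)
    (mTm F \<Gamma> (K C \<Gamma> \<Delta>) t) = map_K \<Gamma> \<Delta> t"
  using assms map_K_q[OF assms(1,2)] C.q_tm_beta[of \<Gamma> \<Gamma> "K C \<Gamma> \<Delta>" "id_sub C \<Gamma>" t] unfolding F_K_def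
  by (subst pull_app) (simp_all add: m_closed map_K_subst C.K_sub D.K_sub sect_def)

lemma F_K_reindex:
  assumes "\<Gamma> \<in> Con C" "\<Delta> \<in> Con C" "\<Theta> \<in> Con C" "\<sigma> \<in> Sub C \<Gamma> \<Delta>"
  shows "reindex D (mCon F \<Gamma>) (mCon F \<Delta>) (mTy F \<Delta> (K C \<Delta> \<Theta>)) (K D (mCon F \<Delta>) (mCon F \<Theta>))
         (mSub F \<Gamma> \<Delta> \<sigma>) (F_K \<Delta> \<Theta>) = F_K \<Gamma> \<Theta>"
proof -
  let ?\<Gamma> = "ext C \<Gamma> (K C \<Gamma> \<Theta>)"
  let ?\<sigma> = "comp_sub C ?\<Gamma> \<Gamma> \<Delta> \<sigma> (p_sub C \<Gamma> (K C \<Gamma> \<Theta>))"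
  have \<sigma>: "?\<sigma> \<in> Sub C ?\<Gamma> \<Delta>" "q_tm C \<Gamma> (K C \<Gamma> \<Theta>) \<in> Tm C ?\<Gamma> (ty_sub C ?\<Gamma> \<Delta> (K C \<Delta> \<Theta>) ?\<sigma>)"
    using assms by (simp_all add: C.fl_closed C.K_sub)
  then show ?thesis
    using assms map_K_q[OF assms(2,3)] C.q_tm_beta[of ?\<Gamma> \<Delta> "K C \<Delta> \<Theta>" ?\<sigma> "q_tm C \<Gamma> (K C \<Gamma> \<Theta>)"]
    unfolding F_K_def
    by (subst pull_reindex) (simp_all add: m_closed map_K_subst C.K_sub D.K_sub lift_sub_def Let_def)
qed

section \<open>The inverse for constant families\<close>

text \<open>Both \<open>F (appK q)\<close> and \<open>F (appK (lamK id))\<close> factor through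
  \<open>F\<close> of \<open>\<bullet> \<triangleright> K \<Delta>\<close>. The resulting
  substitutions from \<open>X\<close> agree: in the first component by uniqueness into
  \<open>F \<bullet>\<close>, in the second because both give \<open>L[s]\<close>. Hence the left
  side is \<open>F (appK (lamK id)) \<circ> s\<close>, which is \<open>s\<close>.\<close>

lemma appK_q_ext_inv:
  assumes \<Gamma>: "\<Gamma> \<in> Con C" "\<Delta> \<in> Con C" and X: "X \<in> Con D" "\<tau> \<in> Sub D X (mCon F \<Gamma>)" "s \<in> Sub D X (mCon F \<Delta>)"
  defines "T \<equiv> K C \<Gamma> \<Delta>" and "L \<equiv> mTm F \<Delta> (K C \<Delta> \<Delta>) (lamK C \<Delta> \<Delta> (id_sub C \<Delta>))"
  shows "comp_sub D X (mCon F (ext C \<Gamma> T)) (mCon F \<Delta>) (mSub F (ext C \<Gamma> T) \<Delta> (appK C (ext C \<Gamma> T) \<Delta>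
      (q_tm C \<Gamma> T)))
     (comp_sub D X (ext D (mCon F \<Gamma>) (mTy F \<Gamma> T)) (mCon F (ext C \<Gamma> T)) (ext_inv \<Gamma> T)
       (pair_sub D X (mCon F \<Gamma>) (mTy F \<Gamma> T) \<tau> (tm_sub D X (mCon F \<Delta>) (mTy F \<Delta> (K C \<Delta> \<Delta>)) L s))) = s"
proof -
  let ?Z = "emp C" and ?\<Gamma> = "ext C \<Gamma> T"
  let ?K = "K C ?Z \<Delta>"
  let ?Z' = "ext C ?Z ?K"
  let ?FK = "mTy F ?Z ?K"
  let ?q = "q_tm C ?Z ?K"
  let ?a = "mSub F ?Z' \<Delta> (appK C ?Z' \<Delta> ?q)"
  have T: "T \<in> Ty C \<Gamma>" "?\<Gamma> \<in> Con C" "?K \<in> Ty C ?Z" "?Z' \<in> Con C" "appK C ?Z' \<Delta> ?q \<in> Sub C ?Z' \<Delta>"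
    "?q \<in> Tm C ?Z' (K C ?Z' \<Delta>)" "?Z \<in> Con C"
    using \<Gamma> by (simp_all add: T_def C.fl_closed C.K_sub)
  have Ke: "ty_sub C Y ?Z ?K \<epsilon> = K C Y \<Delta>" if "Y \<in> Con C" "\<epsilon> \<in> Sub C Y ?Z" for Y \<epsilon>
    using that \<Gamma> by (simp add: C.K_sub C.fl_closed)
  \<comment> \<open>\<open>appK t\<close> is the instance of \<open>appK q\<close> over
    \<open>\<bullet> \<triangleright> K \<Delta>\<close> along \<open>(eps, t)\<close>.\<close>
  have factor: "mSub F Y \<Delta> (appK C Y \<Delta> t)
      = comp_sub D (mCon F Y) (mCon F ?Z') (mCon F \<Delta>) ?a (mSub F Y ?Z' (pair_sub C Y ?Z ?K (eps C Y) t))"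
    if "Y \<in> Con C" "t \<in> Tm C Y (K C Y \<Delta>)" for Y t
  proof -
    let ?r = "pair_sub C Y ?Z ?K (eps C Y) t"
    have r: "?r \<in> Sub C Y ?Z'"
      using that T Ke by (simp add: C.fl_closed)
    have "appK C Y \<Delta> t = comp_sub C Y ?Z' \<Delta> (appK C ?Z' \<Delta> ?q) ?r"
      using C.appK_subst[of Y ?Z' \<Delta> ?r ?q] C.q_tm_beta[of Y ?Z ?K "eps C Y" t] that r \<Gamma> T Ke
      by (simp add: C.fl_closed C.K_sub)
    then show ?thesis
      using that r \<Gamma> T by (simp add: mSub_comp)
  qed
  have pair: "comp_sub D X (mCon F Y) (mCon F ?Z') (mSub F Y ?Z' (pair_sub C Y ?Z ?K (eps C Y) t)) \<upsilon>
      = comp_sub D X (ext D (mCon F ?Z) ?FK) (mCon F ?Z') (ext_inv ?Z ?K)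
         (pair_sub D X (mCon F ?Z) ?FK (comp_sub D X (mCon F Y) (mCon F ?Z) (mSub F Y ?Z (eps C Y)) \<upsilon>)
         (tm_sub D X (mCon F Y) (mTy F Y (K C Y \<Delta>)) (mTm F Y (K C Y \<Delta>) t) \<upsilon>))"
    if "Y \<in> Con C" "t \<in> Tm C Y (K C Y \<Delta>)" "\<upsilon> \<in> Sub D X (mCon F Y)" for Y t \<upsilon>
    using that X \<Gamma> T Ke by (simp add: mSub_pair m_closed D.cwf_simps mTy_K_emp[OF that(1) \<Gamma>(2)])
  have L: "lamK C \<Delta> \<Delta> (id_sub C \<Delta>) \<in> Tm C \<Delta> (K C \<Delta> \<Delta>)" "L \<in> Tm D (mCon F \<Delta>) (mTy F \<Delta> (K C \<Delta> \<Delta>))"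
    using \<Gamma> by (simp_all add: L_def m_closed)
  let ?Ls = "tm_sub D X (mCon F \<Delta>) (mTy F \<Delta> (K C \<Delta> \<Delta>)) L s"
  \<comment> \<open>\<open>L[s]\<close> is typed by way of \<Delta>, whereas the pairing asks for a
    type coming from \<Gamma>; constancy identifies the two.\<close>
  have Ls: "?Ls \<in> Tm D X (ty_sub D X (mCon F \<Gamma>) (mTy F \<Gamma> T) \<tau>)"
    unfolding T_def mTy_K_const[OF \<Gamma> \<Gamma>(2) X] using \<Gamma> X L by (simp add: m_closed)
  let ?\<upsilon> = "comp_sub D X (ext D (mCon F \<Gamma>) (mTy F \<Gamma> T)) (mCon F ?\<Gamma>) (ext_inv \<Gamma> T)
       (pair_sub D X (mCon F \<Gamma>) (mTy F \<Gamma> T) \<tau> ?Ls)"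
  have \<upsilon>: "?\<upsilon> \<in> Sub D X (mCon F ?\<Gamma>)"
    using \<Gamma> X T Ls by (simp add: m_closed)
  have q: "q_tm C \<Gamma> T \<in> Tm C ?\<Gamma> (K C ?\<Gamma> \<Delta>)"
    "tm_sub D X (mCon F ?\<Gamma>) (mTy F ?\<Gamma> (K C ?\<Gamma> \<Delta>)) (mTm F ?\<Gamma> (K C ?\<Gamma> \<Delta>) (q_tm C \<Gamma> T)) ?\<upsilon> = ?Ls"
  proof -
    have K: "K C ?\<Gamma> \<Delta> = ty_sub C ?\<Gamma> \<Gamma> T (p_sub C \<Gamma> T)"
      using \<Gamma> by (simp add: T_def C.fl_closed C.K_sub)
    show "q_tm C \<Gamma> T \<in> Tm C ?\<Gamma> (K C ?\<Gamma> \<Delta>)"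
      unfolding K using \<Gamma> T by (simp add: C.fl_closed)
    show "tm_sub D X (mCon F ?\<Gamma>) (mTy F ?\<Gamma> (K C ?\<Gamma> \<Delta>)) (mTm F ?\<Gamma> (K C ?\<Gamma> \<Delta>) (q_tm C \<Gamma> T)) ?\<upsilon> = ?Ls"
      unfolding K using \<Gamma> X T Ls by (simp add: q_ext_inv_comp m_closed D.cwf_simps)
  qed
  have eps: "comp_sub D X (mCon F ?\<Gamma>) (mCon F ?Z) (mSub F ?\<Gamma> ?Z (eps C ?\<Gamma>)) ?\<upsilon>
    = comp_sub D X (mCon F \<Delta>) (mCon F ?Z) (mSub F \<Delta> ?Z (eps C \<Delta>)) s"
    using \<Gamma> X(1,3) T(2) \<upsilon>
    by (intro F_emp_unique[OF X(1)])
      (simp_all add: D.comp_closed mSub_closed mCon_closed C.eps_closed C.emp_closed)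
  note pair\<upsilon> = pair[OF T(2) q(1) \<upsilon>, unfolded q(2) eps] and pairs = pair[OF \<Gamma>(2) L(1) X(3), folded L_def]
  have sub: "mSub F Y ?Z' (pair_sub C Y ?Z ?K (eps C Y) t) \<in> Sub D (mCon F Y) (mCon F ?Z')"
    if "Y \<in> Con C" "t \<in> Tm C Y (K C Y \<Delta>)" for Y t
    using that T Ke by (simp add: m_closed)
  have a: "?a \<in> Sub D (mCon F ?Z') (mCon F \<Delta>)"
    using \<Gamma> T by (simp add: mSub_closed)
  note assoc = D.comp_assoc[OF X(1) mCon_closed mCon_closed[OF T(4)] mCon_closed[OF \<Gamma>(2)] _ sub a]
  have "comp_sub D X (mCon F ?\<Gamma>) (mCon F \<Delta>) (mSub F ?\<Gamma> \<Delta> (appK C ?\<Gamma> \<Delta> (q_tm C \<Gamma> T))) ?\<upsilon>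
    = comp_sub D X (mCon F \<Delta>) (mCon F \<Delta>) (mSub F \<Delta> \<Delta> (appK C \<Delta> \<Delta> (lamK C \<Delta> \<Delta> (id_sub C \<Delta>)))) s"
    unfolding factor[OF T(2) q(1)] factor[OF \<Gamma>(2) L(1)]
      assoc[OF T(2) \<upsilon> T(2) q(1)] assoc[OF \<Gamma>(2) X(3) \<Gamma>(2) L(1)] pair\<upsilon> pairs ..
  also have "\<dots> = s"
    using \<Gamma> X by (simp add: m_closed C.fl_simps D.fl_simps mSub_id)
  finally show ?thesis .
qed

lemma F_K_iso:
  assumes \<Gamma>: "\<Gamma> \<in> Con C" "\<Delta> \<in> Con C"
  shows "ty_iso D (mCon F \<Gamma>) (mTy F \<Gamma> (K C \<Gamma> \<Delta>)) (K D (mCon F \<Gamma>) (mCon F \<Delta>)) (F_K \<Gamma> \<Delta>)"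
proof -
  let ?T = "K C \<Gamma> \<Delta>" and ?S = "K D (mCon F \<Gamma>) (mCon F \<Delta>)" and ?F\<Gamma> = "mCon F \<Gamma>" and ?F\<Delta> = "mCon F \<Delta>"
  let ?FT = "mTy F \<Gamma> ?T" and ?\<Gamma> = "ext C \<Gamma> ?T"
  let ?X = "ext D ?F\<Gamma> ?FT" and ?Y = "ext D ?F\<Gamma> ?S"
  let ?pX = "p_sub D ?F\<Gamma> ?FT" and ?pY = "p_sub D ?F\<Gamma> ?S" and ?qY = "q_tm D ?F\<Gamma> ?S"
  let ?KD = "K C \<Delta> \<Delta>" and ?q = "q_tm C \<Gamma> ?T"
  let ?l = "lamK C \<Delta> \<Delta> (id_sub C \<Delta>)"
  let ?L = "mTm F \<Delta> ?KD ?l"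
  let ?a = "appK C ?\<Gamma> \<Delta> ?q" and ?b = "appK D ?Y ?F\<Delta> ?qY"
  \<comment> \<open>The inverse: \<open>F (lamK id)\<close> substituted along \<open>?b\<close>, the
    substitution encoded by the generic term of \<open>K (F \<Delta>)\<close>.\<close>
  let ?u = "tm_sub D ?Y ?F\<Delta> (mTy F \<Delta> ?KD) ?L ?b"
  let ?e = "comp_sub D ?X (mCon F ?\<Gamma>) ?F\<Delta> (mSub F ?\<Gamma> \<Delta> ?a) (ext_inv \<Gamma> ?T)"
  have T: "?T \<in> Ty C \<Gamma>" "?\<Gamma> \<in> Con C" "?KD \<in> Ty C \<Delta>" "?l \<in> Tm C \<Delta> ?KD" "?q \<in> Tm C ?\<Gamma> (K C ?\<Gamma> \<Delta>)"
    using \<Gamma> by (simp_all add: C.fl_closed C.K_sub)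
  have a: "?a \<in> Sub C ?\<Gamma> \<Delta>" "ty_sub C ?\<Gamma> \<Delta> ?KD ?a = K C ?\<Gamma> \<Delta>"
    "K C ?\<Gamma> \<Delta> = ty_sub C ?\<Gamma> \<Gamma> ?T (p_sub C \<Gamma> ?T)"
    using \<Gamma> T by (simp_all add: C.fl_closed C.K_sub)
  have D: "?F\<Gamma> \<in> Con D" "?F\<Delta> \<in> Con D" "?S \<in> Ty D ?F\<Gamma>" "?FT \<in> Ty D ?F\<Gamma>" "mCon F ?\<Gamma> \<in> Con D"
    "mTy F \<Delta> ?KD \<in> Ty D ?F\<Delta>" "?L \<in> Tm D ?F\<Delta> (mTy F \<Delta> ?KD)" "mSub F ?\<Gamma> \<Delta> ?a \<in> Sub D (mCon F ?\<Gamma>) ?F\<Delta>"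
    "ext_inv \<Gamma> ?T \<in> Sub D ?X (mCon F ?\<Gamma>)"
    using \<Gamma> T a(1) by (simp_all add: m_closed)
  have X: "?X \<in> Con D" "?pX \<in> Sub D ?X ?F\<Gamma>"
    using D(1,4) by (simp_all add: D.fl_closed)
  have Y: "?Y \<in> Con D" "?pY \<in> Sub D ?Y ?F\<Gamma>" "?qY \<in> Tm D ?Y (K D ?Y ?F\<Delta>)"
    using D(1-3) by (simp_all add: D.fl_closed D.K_sub)
  have e: "?e \<in> Sub D ?X ?F\<Delta>"
    by (rule D.comp_closed[OF X(1) D(5,2,9,8)])
  have b: "?b \<in> Sub D ?Y ?F\<Delta>"
    by (rule D.appK_closed[OF Y(1) D(2) Y(3)])
  have S: "ty_sub D ?X ?F\<Gamma> ?S ?pX = K D ?X ?F\<Delta>" "ty_sub D ?Y ?F\<Gamma> ?S ?pY = K D ?Y ?F\<Delta>"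
    using D X Y(1,2) by (simp_all add: D.K_sub)
  \<comment> \<open>Stability of \<open>lamK\<close> absorbs the transport, so the morphism is
    itself a \<open>lamK\<close>.\<close>
  have f: "F_K \<Gamma> \<Delta> = lamK D ?X ?F\<Delta> ?e"
    unfolding F_K_def pull_def map_K_def
    using \<Gamma> D T X by (simp add: m_closed D.K_sub D.lamK_sub)
  have f_closed: "F_K \<Gamma> \<Delta> \<in> Tm D ?X (ty_sub D ?X ?F\<Gamma> ?S ?pX)"
    unfolding S f by (rule D.lamK_closed[OF X(1) D(2) e])
  have u_ty: "ty_sub D ?Y ?F\<Gamma> ?FT ?pY = ty_sub D ?Y ?F\<Delta> (mTy F \<Delta> ?KD) ?b"
    by (rule mTy_K_const[OF \<Gamma> \<Gamma>(2) Y(1,2) b])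
  have u: "?u \<in> Tm D ?Y (ty_sub D ?Y ?F\<Gamma> ?FT ?pY)"
    unfolding u_ty by (rule D.tm_sub_closed[OF Y(1) D(2,6,7) b])
  have k: "pair_sub D ?Y ?F\<Gamma> ?FT ?pY ?u \<in> Sub D ?Y ?X"
    by (rule D.pair_sub_closed[OF Y(1) D(1,4) Y(2) u])
  \<comment> \<open>The composite is \<open>lamK\<close> of \<open>?e \<circ> (p, u)\<close>, which
    \<open>appK_q_ext_inv\<close> reduces to \<open>lamK ?b\<close>, that is,
    \<open>lamK (appK q)\<close>.\<close>
  have fu: "tm_sub D ?Y ?X (ty_sub D ?X ?F\<Gamma> ?S ?pX) (F_K \<Gamma> \<Delta>) (pair_sub D ?Y ?F\<Gamma> ?FT ?pY ?u) = ?qY"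
    unfolding S f D.lamK_sub[OF Y(1) X(1) D(2) k e] D.comp_assoc[OF Y(1) X(1) D(5,2) k D(9,8)]
      appK_q_ext_inv[OF \<Gamma> Y(1,2) b] by (rule D.lamK_appK[OF Y(1) D(2) Y(3)])
  let ?k = "pair_sub D ?X ?F\<Gamma> ?S ?pX (F_K \<Gamma> \<Delta>)"
  have k': "?k \<in> Sub D ?X ?Y"
    by (rule D.pair_sub_closed[OF X(1) D(1,3) X(2) f_closed])
  have uf: "tm_sub D ?X ?Y (ty_sub D ?Y ?F\<Gamma> ?FT ?pY) ?u ?k = q_tm D ?F\<Gamma> ?FT"
  proof -
    have "tm_sub D ?X ?Y (ty_sub D ?Y ?F\<Gamma> ?FT ?pY) ?u ?k
      = tm_sub D ?X ?F\<Delta> (mTy F \<Delta> ?KD) ?L (comp_sub D ?X ?Y ?F\<Delta> ?b ?k)"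
      by (rule D.tm_sub_tm_sub[OF X(1) Y(1) D(2,6,7) k' b u_ty])
    also have "comp_sub D ?X ?Y ?F\<Delta> ?b ?k = appK D ?X ?F\<Delta> (F_K \<Gamma> \<Delta>)"
      using D.appK_subst[OF X(1) Y(1) D(2) k' Y(3)] D.q_tm_beta[OF X(1) D(1,3) X(2) f_closed]
      unfolding S by simp
    also have "\<dots> = ?e"
      unfolding f by (rule D.appK_lamK[OF X(1) D(2) e])
    also have "tm_sub D ?X ?F\<Delta> (mTy F \<Delta> ?KD) ?L ?e
      = tm_sub D ?X (mCon F ?\<Gamma>) (mTy F ?\<Gamma> (ty_sub C ?\<Gamma> \<Delta> ?KD ?a))
          (mTm F ?\<Gamma> (ty_sub C ?\<Gamma> \<Delta> ?KD ?a) (tm_sub C ?\<Gamma> \<Delta> ?KD ?l ?a)) (ext_inv \<Gamma> ?T)"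
      unfolding mTy_sub[OF T(2) \<Gamma>(2) T(3) a(1)] mTm_sub[OF T(2) \<Gamma>(2) T(3,4) a(1)]
      by (rule D.tm_sub_comp[OF X(1) D(5,2,6,7,9,8)])
    \<comment> \<open>\<open>lamK id\<close> substituted along \<open>appK q\<close> is
      \<open>lamK (appK q)\<close>.\<close>
    also have "tm_sub C ?\<Gamma> \<Delta> ?KD ?l ?a = ?q"
      using \<Gamma> T a(1) by (simp add: C.lamK_sub C.fl_closed C.fl_simps)
    also have "tm_sub D ?X (mCon F ?\<Gamma>) (mTy F ?\<Gamma> (ty_sub C ?\<Gamma> \<Delta> ?KD ?a))
          (mTm F ?\<Gamma> (ty_sub C ?\<Gamma> \<Delta> ?KD ?a) ?q) (ext_inv \<Gamma> ?T) = q_tm D ?F\<Gamma> ?FT"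
      unfolding a(2) by (rule q_ext_inv[OF \<Gamma>(1) T(1) refl a(3) refl])
    finally show ?thesis .
  qed
  show ?thesis
    by (rule D.ty_isoI[OF D(1,4,3) f_closed u fu uf])
qed

end

section \<open>Identity types\<close>

context weak_flcwf_morphism
begin

text \<open>Reflexivity at \<open>F (t[p])\<close> has the required type because
  \<open>t[p] = u[p]\<close> over \<open>\<Gamma> \<triangleright> Idt A t u\<close>.\<close>

definition F_Id :: "'con1 \<Rightarrow> 'ty1 \<Rightarrow> 'tm1 \<Rightarrow> 'tm1 \<Rightarrow> 'tm2" where
  "F_Id \<Gamma> A t u = (let T = Idt C \<Gamma> A t u; \<Gamma>' = ext C \<Gamma> T; A' = ty_sub C \<Gamma>' \<Gamma> A (p_sub C \<Gamma> T)
     in pull \<Gamma> T (Idt D (mCon F \<Gamma>) (mTy F \<Gamma> A) (mTm F \<Gamma> A t) (mTm F \<Gamma> A u))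
          (rfl D (mCon F \<Gamma>') (mTy F \<Gamma>' A') (mTm F \<Gamma>' A' (tm_sub C \<Gamma>' \<Gamma> A t (p_sub C \<Gamma> T)))))"

context
  fixes \<Gamma> A t u
  assumes \<Gamma>: "\<Gamma> \<in> Con C" "A \<in> Ty C \<Gamma>" "t \<in> Tm C \<Gamma> A" "u \<in> Tm C \<Gamma> A"
begin

text \<open>Reflection applied to the generic identity proof \<open>q\<close>.\<close>

lemma Id_ext_eq:
  fixes T defines "T \<equiv> Idt C \<Gamma> A t u"
  shows "tm_sub C (ext C \<Gamma> T) \<Gamma> A t (p_sub C \<Gamma> T) = tm_sub C (ext C \<Gamma> T) \<Gamma> A u (p_sub C \<Gamma> T)"
  by (rule C.Idt_reflection[where e = "q_tm C \<Gamma> T"]) (use \<Gamma> in \<open>simp_all add: T_def C.fl_closed\<close>)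

lemma IdF_closed: "Idt D (mCon F \<Gamma>) (mTy F \<Gamma> A) (mTm F \<Gamma> A t) (mTm F \<Gamma> A u) \<in> Ty D (mCon F \<Gamma>)"
  using \<Gamma> by (simp add: m_closed)

lemma F_Id_arg_closed:
  defines "T \<equiv> Idt C \<Gamma> A t u"
  defines "\<Gamma>' \<equiv> ext C \<Gamma> T"
  defines "A' \<equiv> ty_sub C \<Gamma>' \<Gamma> A (p_sub C \<Gamma> T)"
  shows "rfl D (mCon F \<Gamma>') (mTy F \<Gamma>' A') (mTm F \<Gamma>' A' (tm_sub C \<Gamma>' \<Gamma> A t (p_sub C \<Gamma> T)))
    \<in> Tm D (mCon F \<Gamma>') (ty_sub D (mCon F \<Gamma>') (mCon F \<Gamma>)
        (Idt D (mCon F \<Gamma>) (mTy F \<Gamma> A) (mTm F \<Gamma> A t) (mTm F \<Gamma> A u)) (mSub F \<Gamma>' \<Gamma> (p_sub C \<Gamma> T)))"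
proof -
  let ?p = "p_sub C \<Gamma> T"
  have T: "\<Gamma>' \<in> Con C" "?p \<in> Sub C \<Gamma>' \<Gamma>" "A' \<in> Ty C \<Gamma>'" "tm_sub C \<Gamma>' \<Gamma> A t ?p \<in> Tm C \<Gamma>' A'"
    using \<Gamma> unfolding A'_def \<Gamma>'_def T_def by (simp_all add: C.fl_closed)
  have eq: "tm_sub C \<Gamma>' \<Gamma> A t ?p = tm_sub C \<Gamma>' \<Gamma> A u ?p"
    unfolding \<Gamma>'_def T_def by (rule Id_ext_eq)
  have "ty_sub D (mCon F \<Gamma>') (mCon F \<Gamma>) (Idt D (mCon F \<Gamma>) (mTy F \<Gamma> A) (mTm F \<Gamma> A t) (mTm F \<Gamma> A u))
      (mSub F \<Gamma>' \<Gamma> ?p)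
    = Idt D (mCon F \<Gamma>') (mTy F \<Gamma>' A') (mTm F \<Gamma>' A' (tm_sub C \<Gamma>' \<Gamma> A t ?p)) (mTm F \<Gamma>' A'
        (tm_sub C \<Gamma>' \<Gamma> A u ?p))"
    using \<Gamma> T unfolding A'_def by (simp add: m_closed D.Idt_sub mTy_sub mTm_sub)
  then show ?thesis
    using T unfolding eq[symmetric] by (simp add: D.rfl_closed m_closed)
qed

lemma F_Id_closed:
  fixes S defines "S \<equiv> Idt D (mCon F \<Gamma>) (mTy F \<Gamma> A) (mTm F \<Gamma> A t) (mTm F \<Gamma> A u)"
  fixes X defines "X \<equiv> ext D (mCon F \<Gamma>) (mTy F \<Gamma> (Idt C \<Gamma> A t u))"
  shows "F_Id \<Gamma> A t u \<in> Tm D X (ty_sub D X (mCon F \<Gamma>) S (p_sub D (mCon F \<Gamma>) (mTy F \<Gamma> (Idt C \<Gamma> A t u))))"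
  unfolding F_Id_def Let_def S_def X_def
  by (rule pull_closed[OF \<Gamma>(1) C.Idt_closed[OF \<Gamma>] IdF_closed F_Id_arg_closed])

end

section \<open>The inverse for identity types\<close>

text \<open>\<open>u\<close> and \<open>v\<close> may differ in \<open>C\<close>. Each
  \<open>Idt A t w\<close> is the instance along \<open>(id, w)\<close> of a single type over
  \<open>\<Gamma> \<triangleright> A\<close>, and \<open>F (id, w) \<circ> \<sigma>\<close> depends
  on \<open>w\<close> only through \<open>(F w)[\<sigma>]\<close>.\<close>

lemma mTy_Idt_cong:
  assumes \<Gamma>: "\<Gamma> \<in> Con C" "A \<in> Ty C \<Gamma>" "t \<in> Tm C \<Gamma> A" "u \<in> Tm C \<Gamma> A" "v \<in> Tm C \<Gamma> A"
    and X: "X \<in> Con D" "\<sigma> \<in> Sub D X (mCon F \<Gamma>)"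
    and eq: "tm_sub D X (mCon F \<Gamma>) (mTy F \<Gamma> A) (mTm F \<Gamma> A u) \<sigma>
      = tm_sub D X (mCon F \<Gamma>) (mTy F \<Gamma> A) (mTm F \<Gamma> A v) \<sigma>"
  shows "ty_sub D X (mCon F \<Gamma>) (mTy F \<Gamma> (Idt C \<Gamma> A t u)) \<sigma>
    = ty_sub D X (mCon F \<Gamma>) (mTy F \<Gamma> (Idt C \<Gamma> A t v)) \<sigma>"
proof -
  let ?\<Gamma> = "ext C \<Gamma> A" and ?p = "p_sub C \<Gamma> A"
  let ?A = "ty_sub C ?\<Gamma> \<Gamma> A ?p"
  let ?I = "Idt C ?\<Gamma> ?A (tm_sub C ?\<Gamma> \<Gamma> A t ?p) (q_tm C \<Gamma> A)"
  have I: "?I \<in> Ty C ?\<Gamma>"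
    using \<Gamma> by (simp add: C.fl_closed)
  have "ty_sub D X (mCon F \<Gamma>) (mTy F \<Gamma> (Idt C \<Gamma> A t w)) \<sigma>
    = ty_sub D X (mCon F ?\<Gamma>) (mTy F ?\<Gamma> ?I)
      (comp_sub D X (ext D (mCon F \<Gamma>) (mTy F \<Gamma> A)) (mCon F ?\<Gamma>) (ext_inv \<Gamma> A)
        (pair_sub D X (mCon F \<Gamma>) (mTy F \<Gamma> A) \<sigma> (tm_sub D X (mCon F \<Gamma>) (mTy F \<Gamma> A) (mTm F \<Gamma> A w) \<sigma>)))"
    if w: "w \<in> Tm C \<Gamma> A" for w
  proof -
    have s: "pair_sub C \<Gamma> \<Gamma> A (id_sub C \<Gamma>) w \<in> Sub C \<Gamma> ?\<Gamma>"
      using \<Gamma> w by (simp add: C.fl_closed C.fl_simps)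
    have "Idt C \<Gamma> A t w = ty_sub C \<Gamma> ?\<Gamma> ?I (pair_sub C \<Gamma> \<Gamma> A (id_sub C \<Gamma>) w)"
      using \<Gamma> w by (simp add: C.fl_closed C.fl_simps)
    then have "mTy F \<Gamma> (Idt C \<Gamma> A t w)
      = ty_sub D (mCon F \<Gamma>) (mCon F ?\<Gamma>) (mTy F ?\<Gamma> ?I) (mSub F \<Gamma> ?\<Gamma> (pair_sub C \<Gamma> \<Gamma> A (id_sub C \<Gamma>) w))"
      using mTy_sub[OF \<Gamma>(1) C.ext_closed[OF \<Gamma>(1,2)] I s] by simp
    then show ?thesis
      using \<Gamma> X w I s by (simp add: mSub_pair m_closed C.cwf_simps D.cwf_simps mSub_id)
  qed
  then show ?thesis
    using \<Gamma>(4,5) eq by simp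
qed

lemma F_Id_iso:
  assumes \<Gamma>: "\<Gamma> \<in> Con C" "A \<in> Ty C \<Gamma>" "t \<in> Tm C \<Gamma> A" "u \<in> Tm C \<Gamma> A"
  shows "ty_iso D (mCon F \<Gamma>) (mTy F \<Gamma> (Idt C \<Gamma> A t u))
    (Idt D (mCon F \<Gamma>) (mTy F \<Gamma> A) (mTm F \<Gamma> A t) (mTm F \<Gamma> A u)) (F_Id \<Gamma> A t u)"
proof -
  let ?T = "Idt C \<Gamma> A t u" and ?U = "Idt C \<Gamma> A t t" and ?F\<Gamma> = "mCon F \<Gamma>" and ?FA = "mTy F \<Gamma> A"
  let ?S = "Idt D ?F\<Gamma> ?FA (mTm F \<Gamma> A t) (mTm F \<Gamma> A u)"
  let ?FT = "mTy F \<Gamma> ?T" and ?\<Gamma> = "ext C \<Gamma> ?T" and ?p = "p_sub C \<Gamma> ?T" and ?q = "q_tm C \<Gamma> ?T"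
  let ?X = "ext D ?F\<Gamma> ?FT" and ?Y = "ext D ?F\<Gamma> ?S"
  let ?pX = "p_sub D ?F\<Gamma> ?FT" and ?pY = "p_sub D ?F\<Gamma> ?S" and ?qY = "q_tm D ?F\<Gamma> ?S"
  let ?r = "rfl C \<Gamma> A t"
  let ?Fr = "mTm F \<Gamma> ?U ?r" and ?FU = "mTy F \<Gamma> ?U"
  let ?g = "tm_sub D ?Y ?F\<Gamma> ?FU ?Fr ?pY"
  note f = F_Id_closed[OF \<Gamma>]
  have T: "?T \<in> Ty C \<Gamma>" "?\<Gamma> \<in> Con C" "?p \<in> Sub C ?\<Gamma> \<Gamma>" "?q \<in> Tm C ?\<Gamma> (ty_sub C ?\<Gamma> \<Gamma> ?T ?p)"
    "?U \<in> Ty C \<Gamma>" "?r \<in> Tm C \<Gamma> ?U"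
    using \<Gamma> by (simp_all add: C.fl_closed C.rfl_closed)
  have D: "?F\<Gamma> \<in> Con D" "?FT \<in> Ty D ?F\<Gamma>" "?S \<in> Ty D ?F\<Gamma>" "?FU \<in> Ty D ?F\<Gamma>" "?Fr \<in> Tm D ?F\<Gamma> ?FU"
    "?FA \<in> Ty D ?F\<Gamma>" "mTm F \<Gamma> A t \<in> Tm D ?F\<Gamma> ?FA" "mTm F \<Gamma> A u \<in> Tm D ?F\<Gamma> ?FA"
    "mCon F ?\<Gamma> \<in> Con D" "mSub F ?\<Gamma> \<Gamma> ?p \<in> Sub D (mCon F ?\<Gamma>) ?F\<Gamma>" "ext_inv \<Gamma> ?T \<in> Sub D ?X (mCon F ?\<Gamma>)"
    using \<Gamma> T by (simp_all add: m_closed)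
  have X: "?X \<in> Con D" "?pX \<in> Sub D ?X ?F\<Gamma>" and Y: "?Y \<in> Con D" "?pY \<in> Sub D ?Y ?F\<Gamma>"
    "?qY \<in> Tm D ?Y (ty_sub D ?Y ?F\<Gamma> ?S ?pY)"
    using D(1,2,3) by (simp_all add: D.cwf_closed)
  \<comment> \<open>Over \<open>F \<Gamma> \<triangleright> S\<close>, reflection in
    \<open>D\<close> equates \<open>F t\<close> and \<open>F u\<close>, so
    \<open>(F refl)[p]\<close> also has the type required of the inverse.\<close>
  have eqY: "ty_sub D ?Y ?F\<Gamma> ?FT ?pY = ty_sub D ?Y ?F\<Gamma> ?FU ?pY"
    by (rule mTy_Idt_cong[OF \<Gamma> \<Gamma>(3) Y(1,2) D.Idt_reflection[OF Y(1) D(1,6,7,8) Y(2,3), symmetric]])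
  have g: "?g \<in> Tm D ?Y (ty_sub D ?Y ?F\<Gamma> ?FT ?pY)"
    unfolding eqY by (rule D.tm_sub_closed[OF Y(1) D(1,4,5) Y(2)])
  let ?k = "pair_sub D ?Y ?F\<Gamma> ?FT ?pY ?g"
  have k: "?k \<in> Sub D ?Y ?X"
    by (rule D.pair_sub_closed[OF Y(1) D(1,2) Y(2) g])
  \<comment> \<open>Both sides are terms of a substituted identity type of \<open>D\<close>, so UIP
    in \<open>D\<close> suffices.\<close>
  have fg: "tm_sub D ?Y ?X (ty_sub D ?X ?F\<Gamma> ?S ?pX) (F_Id \<Gamma> A t u) ?k = ?qY"
  proof (rule D.Idt_unique[OF Y(1) D(1,6,7,8) Y(2) _ Y(3)])
    have "ty_sub D ?Y ?X (ty_sub D ?X ?F\<Gamma> ?S ?pX) ?k = ty_sub D ?Y ?F\<Gamma> ?S ?pY"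
      unfolding D.ty_sub_ty_sub[OF Y(1) X(1) D(1,3) k X(2)] D.p_sub_beta[OF Y(1) D(1,2) Y(2) g] ..
    then show "tm_sub D ?Y ?X (ty_sub D ?X ?F\<Gamma> ?S ?pX) (F_Id \<Gamma> A t u) ?k
      \<in> Tm D ?Y (ty_sub D ?Y ?F\<Gamma> ?S ?pY)"
      using D.tm_sub_closed[OF Y(1) X(1) D.ty_sub_closed[OF X(1) D(1,3) X(2)] f k] by simp
  qed
  let ?h = "pair_sub D ?X ?F\<Gamma> ?S ?pX (F_Id \<Gamma> A t u)"
  have h: "?h \<in> Sub D ?X ?Y"
    by (rule D.pair_sub_closed[OF X(1) D(1,3) X(2) f])
  have UT: "ty_sub C ?\<Gamma> \<Gamma> ?U ?p = ty_sub C ?\<Gamma> \<Gamma> ?T ?p"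
    using \<Gamma> T Id_ext_eq[OF \<Gamma>] by (simp add: C.Idt_sub)
  \<comment> \<open>\<open>F (Idt A t u)\<close> need not be an identity type of \<open>D\<close>,
    so UIP is used in \<open>C\<close>, giving \<open>refl[p] = q\<close>, and the equation is then
    carried over by \<open>F\<close>.\<close>
  have q: "tm_sub C ?\<Gamma> \<Gamma> ?U ?r ?p = ?q"
    using C.tm_sub_closed[OF T(2) \<Gamma>(1) T(5,6,3)] unfolding UT
    by (rule C.Idt_unique[OF T(2) \<Gamma> T(3) _ T(4)])
  have gf: "tm_sub D ?X ?Y (ty_sub D ?Y ?F\<Gamma> ?FT ?pY) ?g ?h = q_tm D ?F\<Gamma> ?FT"
  proof -
    have "tm_sub D ?X ?Y (ty_sub D ?Y ?F\<Gamma> ?FT ?pY) ?g ?h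
      = tm_sub D ?X ?F\<Gamma> ?FU ?Fr (comp_sub D ?X ?Y ?F\<Gamma> ?pY ?h)"
      by (rule D.tm_sub_tm_sub[OF X(1) Y(1) D(1,4,5) h Y(2) eqY])
    also have "comp_sub D ?X ?Y ?F\<Gamma> ?pY ?h
      = comp_sub D ?X (mCon F ?\<Gamma>) ?F\<Gamma> (mSub F ?\<Gamma> \<Gamma> ?p) (ext_inv \<Gamma> ?T)"
      unfolding D.p_sub_beta[OF X(1) D(1,3) X(2) f] by (rule p_ext_inv[OF \<Gamma>(1) T(1) refl, symmetric])
    also have "tm_sub D ?X ?F\<Gamma> ?FU ?Fr \<dots> = tm_sub D ?X (mCon F ?\<Gamma>) (mTy F ?\<Gamma> (ty_sub C ?\<Gamma> \<Gamma> ?U ?p))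
        (mTm F ?\<Gamma> (ty_sub C ?\<Gamma> \<Gamma> ?U ?p) (tm_sub C ?\<Gamma> \<Gamma> ?U ?r ?p)) (ext_inv \<Gamma> ?T)"
      unfolding mTy_sub[OF T(2) \<Gamma>(1) T(5,3)] mTm_sub[OF T(2) \<Gamma>(1) T(5,6,3)]
      by (rule D.tm_sub_comp[OF X(1) D(9,1,4,5,11,10)])
    also have "\<dots> = q_tm D ?F\<Gamma> ?FT"
      unfolding q by (rule q_ext_inv[OF \<Gamma>(1) T(1) refl UT refl])
    finally show ?thesis .
  qed
  show ?thesis
    by (rule D.ty_isoI[OF D(1,2,3) f g fg gf])
qed

text \<open>Once source and target types are matched, both sides are terms of one substituted
  identity type of \<open>D\<close>, and UIP applies.\<close>

lemma F_Id_reindex: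
  assumes \<Gamma>: "\<Gamma> \<in> Con C" and \<Delta>: "\<Delta> \<in> Con C" "A \<in> Ty C \<Delta>" "t \<in> Tm C \<Delta> A" "u \<in> Tm C \<Delta> A" and \<sigma>: "\<sigma>
      \<in> Sub C \<Gamma> \<Delta>"
  shows "reindex D (mCon F \<Gamma>) (mCon F \<Delta>) (mTy F \<Delta> (Idt C \<Delta> A t u))
      (Idt D (mCon F \<Delta>) (mTy F \<Delta> A) (mTm F \<Delta> A t) (mTm F \<Delta> A u)) (mSub F \<Gamma> \<Delta> \<sigma>) (F_Id \<Delta> A t u)
    = F_Id \<Gamma> (ty_sub C \<Gamma> \<Delta> A \<sigma>) (tm_sub C \<Gamma> \<Delta> A t \<sigma>) (tm_sub C \<Gamma> \<Delta> A u \<sigma>)"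
proof -
  let ?A = "ty_sub C \<Gamma> \<Delta> A \<sigma>" and ?t = "tm_sub C \<Gamma> \<Delta> A t \<sigma>" and ?u = "tm_sub C \<Gamma> \<Delta> A u \<sigma>"
  let ?T = "Idt C \<Delta> A t u" and ?S = "Idt D (mCon F \<Delta>) (mTy F \<Delta> A) (mTm F \<Delta> A t) (mTm F \<Delta> A u)"
  let ?F\<sigma> = "mSub F \<Gamma> \<Delta> \<sigma>"
  let ?X = "ext D (mCon F \<Gamma>) (mTy F \<Gamma> (Idt C \<Gamma> ?A ?t ?u))"
  have A: "?A \<in> Ty C \<Gamma>" "?t \<in> Tm C \<Gamma> ?A" "?u \<in> Tm C \<Gamma> ?A"
    using assms by (simp_all add: C.fl_closed)
  have T: "ty_sub D (mCon F \<Gamma>) (mCon F \<Delta>) (mTy F \<Delta> ?T) ?F\<sigma> = mTy F \<Gamma> (Idt C \<Gamma> ?A ?t ?u)"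
    using mTy_sub[OF \<Gamma> \<Delta>(1) C.Idt_closed[OF \<Delta>] \<sigma>] assms by (simp add: C.Idt_sub)
  have S: "ty_sub D (mCon F \<Gamma>) (mCon F \<Delta>) ?S ?F\<sigma>
    = Idt D (mCon F \<Gamma>) (mTy F \<Gamma> ?A) (mTm F \<Gamma> ?A ?t) (mTm F \<Gamma> ?A ?u)"
    using assms by (simp add: D.Idt_sub m_closed mTy_sub mTm_sub)
  have F: "mCon F \<Gamma> \<in> Con D" "mTy F \<Gamma> ?A \<in> Ty D (mCon F \<Gamma>)" "mTm F \<Gamma> ?A ?t \<in> Tm D (mCon F \<Gamma>)
      (mTy F \<Gamma> ?A)"
    "mTm F \<Gamma> ?A ?u \<in> Tm D (mCon F \<Gamma>) (mTy F \<Gamma> ?A)"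
    by (simp_all only: mCon_closed mTy_closed mTm_closed \<Gamma> A)
  have FI: "mTy F \<Gamma> (Idt C \<Gamma> ?A ?t ?u) \<in> Ty D (mCon F \<Gamma>)"
    by (simp only: mTy_closed C.Idt_closed \<Gamma> A)
  show ?thesis
    using D.reindex_closed[OF mCon_closed[OF \<Gamma>] mCon_closed[OF \<Delta>(1)]
        mTy_closed[OF \<Delta>(1) C.Idt_closed[OF \<Delta>]] IdF_closed[OF \<Delta>] mSub_closed[OF \<Gamma> \<Delta>(1) \<sigma>] F_Id_closed[OF \<Delta>]]
      F_Id_closed[OF \<Gamma> A]
    unfolding T S
    by (rule D.Idt_unique[OF D.ext_closed[OF F(1) FI] F D.p_sub_closed[OF F(1) FI]])
qed

text \<open>Both sides inhabit the same identity type of \<open>D\<close>.\<close>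

lemma F_Id_rfl:
  assumes \<Gamma>: "\<Gamma> \<in> Con C" "A \<in> Ty C \<Gamma>" "t \<in> Tm C \<Gamma> A"
  shows "ty_app D (mCon F \<Gamma>) (mTy F \<Gamma> (Idt C \<Gamma> A t t))
         (Idt D (mCon F \<Gamma>) (mTy F \<Gamma> A) (mTm F \<Gamma> A t) (mTm F \<Gamma> A t))
         (F_Id \<Gamma> A t t) (mTm F \<Gamma> (Idt C \<Gamma> A t t) (rfl C \<Gamma> A t))
       = rfl D (mCon F \<Gamma>) (mTy F \<Gamma> A) (mTm F \<Gamma> A t)"
proof -
  have F: "mCon F \<Gamma> \<in> Con D" "mTy F \<Gamma> A \<in> Ty D (mCon F \<Gamma>)" "mTm F \<Gamma> A t \<in> Tm D (mCon F \<Gamma>) (mTy F \<Gamma> A)"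
    by (simp_all only: mCon_closed mTy_closed mTm_closed \<Gamma>)
  note T = C.Idt_closed[OF \<Gamma> \<Gamma>(3)]
  show ?thesis
    by (rule D.UIP[OF F F(3) D.ty_app_closed[OF F(1) mTy_closed[OF \<Gamma>(1) T] IdF_closed[OF \<Gamma> \<Gamma>(3)]
            mTm_closed[OF \<Gamma>(1) T C.rfl_closed[OF \<Gamma>]] F_Id_closed[OF \<Gamma> \<Gamma>(3)]]
          D.rfl_closed[OF F]])
qed

end

section \<open>Assembly: preservation of the fl-structure\<close>

theorem theorem2:
  fixes C :: "('con1, 'sub1, 'ty1, 'tm1) flcwf"
    and D :: "('con2, 'sub2, 'ty2, 'tm2) flcwf"
    and F :: "('con1, 'sub1, 'ty1, 'tm1, 'con2, 'sub2, 'ty2, 'tm2) cwf_map"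
  assumes "flcwf C" and "flcwf D" and "weak_flcwf_morphism C D F"
  shows "\<exists>(F_Sig :: 'con1 \<Rightarrow> 'ty1 \<Rightarrow> 'ty1 \<Rightarrow> 'tm2)
          (F_K :: 'con1 \<Rightarrow> 'con1 \<Rightarrow> 'tm2)
          (F_Id :: 'con1 \<Rightarrow> 'ty1 \<Rightarrow> 'tm1 \<Rightarrow> 'tm1 \<Rightarrow> 'tm2).
    \<comment> \<open>type isomorphisms\<close>
    (\<forall>\<Gamma> \<in> Con C. \<forall>A \<in> Ty C \<Gamma>. \<forall>B \<in> Ty C (ext C \<Gamma> A).
       ty_iso D (mCon F \<Gamma>) (mTy F \<Gamma> (Sig C \<Gamma> A B))
         (Sig D (mCon F \<Gamma>) (mTy F \<Gamma> A) (mTy_ext C D F \<Gamma> A B))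
         (F_Sig \<Gamma> A B)) \<and>
    (\<forall>\<Gamma> \<in> Con C. \<forall>\<Delta> \<in> Con C.
       ty_iso D (mCon F \<Gamma>) (mTy F \<Gamma> (K C \<Gamma> \<Delta>)) (K D (mCon F \<Gamma>) (mCon F \<Delta>)) (F_K \<Gamma> \<Delta>)) \<and>
    (\<forall>\<Gamma> \<in> Con C. \<forall>A \<in> Ty C \<Gamma>. \<forall>t \<in> Tm C \<Gamma> A. \<forall>u \<in> Tm C \<Gamma> A.
       ty_iso D (mCon F \<Gamma>) (mTy F \<Gamma> (Idt C \<Gamma> A t u))
         (Idt D (mCon F \<Gamma>) (mTy F \<Gamma> A) (mTm F \<Gamma> A t) (mTm F \<Gamma> A u))
         (F_Id \<Gamma> A t u)) \<and>
    \<comment> \<open>naturality\<close>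
    (\<forall>\<Gamma> \<in> Con C. \<forall>\<Delta> \<in> Con C. \<forall>\<sigma> \<in> Sub C \<Gamma> \<Delta>. \<forall>A \<in> Ty C \<Delta>. \<forall>B \<in> Ty C (ext C \<Delta> A).
       reindex D (mCon F \<Gamma>) (mCon F \<Delta>) (mTy F \<Delta> (Sig C \<Delta> A B))
         (Sig D (mCon F \<Delta>) (mTy F \<Delta> A) (mTy_ext C D F \<Delta> A B))
         (mSub F \<Gamma> \<Delta> \<sigma>) (F_Sig \<Delta> A B)
       = F_Sig \<Gamma> (ty_sub C \<Gamma> \<Delta> A \<sigma>)
           (ty_sub C (ext C \<Gamma> (ty_sub C \<Gamma> \<Delta> A \<sigma>)) (ext C \<Delta> A) B (lift_sub C \<Gamma> \<Delta> A \<sigma>))) \<and>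
    (\<forall>\<Gamma> \<in> Con C. \<forall>\<Delta> \<in> Con C. \<forall>\<sigma> \<in> Sub C \<Gamma> \<Delta>. \<forall>\<Theta> \<in> Con C.
       reindex D (mCon F \<Gamma>) (mCon F \<Delta>) (mTy F \<Delta> (K C \<Delta> \<Theta>)) (K D (mCon F \<Delta>) (mCon F \<Theta>))
         (mSub F \<Gamma> \<Delta> \<sigma>) (F_K \<Delta> \<Theta>)
       = F_K \<Gamma> \<Theta>) \<and>
    (\<forall>\<Gamma> \<in> Con C. \<forall>\<Delta> \<in> Con C. \<forall>\<sigma> \<in> Sub C \<Gamma> \<Delta>. \<forall>A \<in> Ty C \<Delta>. \<forall>t \<in> Tm C \<Delta> A. \<forall>u \<in> Tm C \<Delta> A.
       reindex D (mCon F \<Gamma>) (mCon F \<Delta>) (mTy F \<Delta> (Idt C \<Delta> A t u))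
         (Idt D (mCon F \<Delta>) (mTy F \<Delta> A) (mTm F \<Delta> A t) (mTm F \<Delta> A u))
         (mSub F \<Gamma> \<Delta> \<sigma>) (F_Id \<Delta> A t u)
       = F_Id \<Gamma> (ty_sub C \<Gamma> \<Delta> A \<sigma>) (tm_sub C \<Gamma> \<Delta> A t \<sigma>) (tm_sub C \<Gamma> \<Delta> A u \<sigma>)) \<and>
    \<comment> \<open>preservation of the term and substitution formers\<close>
    (\<forall>\<Gamma> \<in> Con C. \<forall>A \<in> Ty C \<Gamma>. \<forall>B \<in> Ty C (ext C \<Gamma> A). \<forall>t \<in> Tm C \<Gamma> A.
       \<forall>u \<in> Tm C \<Gamma> (ty_sub C \<Gamma> (ext C \<Gamma> A) B (sect C \<Gamma> A t)).
       ty_app D (mCon F \<Gamma>) (mTy F \<Gamma> (Sig C \<Gamma> A B))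
         (Sig D (mCon F \<Gamma>) (mTy F \<Gamma> A) (mTy_ext C D F \<Gamma> A B))
         (F_Sig \<Gamma> A B) (mTm F \<Gamma> (Sig C \<Gamma> A B) (spair C \<Gamma> A B t u))
       = spair D (mCon F \<Gamma>) (mTy F \<Gamma> A) (mTy_ext C D F \<Gamma> A B) (mTm F \<Gamma> A t)
           (mTm F \<Gamma> (ty_sub C \<Gamma> (ext C \<Gamma> A) B (sect C \<Gamma> A t)) u)) \<and>
    (\<forall>\<Gamma> \<in> Con C. \<forall>A \<in> Ty C \<Gamma>. \<forall>B \<in> Ty C (ext C \<Gamma> A). \<forall>t \<in> Tm C \<Gamma> (Sig C \<Gamma> A B).
       mTm F \<Gamma> A (proj1 C \<Gamma> A B t)
       = proj1 D (mCon F \<Gamma>) (mTy F \<Gamma> A) (mTy_ext C D F \<Gamma> A B)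
           (ty_app D (mCon F \<Gamma>) (mTy F \<Gamma> (Sig C \<Gamma> A B))
              (Sig D (mCon F \<Gamma>) (mTy F \<Gamma> A) (mTy_ext C D F \<Gamma> A B))
              (F_Sig \<Gamma> A B) (mTm F \<Gamma> (Sig C \<Gamma> A B) t))) \<and>
    (\<forall>\<Gamma> \<in> Con C. \<forall>A \<in> Ty C \<Gamma>. \<forall>B \<in> Ty C (ext C \<Gamma> A). \<forall>t \<in> Tm C \<Gamma> (Sig C \<Gamma> A B).
       mTm F \<Gamma> (ty_sub C \<Gamma> (ext C \<Gamma> A) B (sect C \<Gamma> A (proj1 C \<Gamma> A B t))) (proj2 C \<Gamma> A B t)
       = proj2 D (mCon F \<Gamma>) (mTy F \<Gamma> A) (mTy_ext C D F \<Gamma> A B)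
           (ty_app D (mCon F \<Gamma>) (mTy F \<Gamma> (Sig C \<Gamma> A B))
              (Sig D (mCon F \<Gamma>) (mTy F \<Gamma> A) (mTy_ext C D F \<Gamma> A B))
              (F_Sig \<Gamma> A B) (mTm F \<Gamma> (Sig C \<Gamma> A B) t))) \<and>
    (\<forall>\<Gamma> \<in> Con C. \<forall>A \<in> Ty C \<Gamma>. \<forall>t \<in> Tm C \<Gamma> A.
       ty_app D (mCon F \<Gamma>) (mTy F \<Gamma> (Idt C \<Gamma> A t t))
         (Idt D (mCon F \<Gamma>) (mTy F \<Gamma> A) (mTm F \<Gamma> A t) (mTm F \<Gamma> A t))
         (F_Id \<Gamma> A t t) (mTm F \<Gamma> (Idt C \<Gamma> A t t) (rfl C \<Gamma> A t))
       = rfl D (mCon F \<Gamma>) (mTy F \<Gamma> A) (mTm F \<Gamma> A t)) \<and>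
    (\<forall>\<Gamma> \<in> Con C. \<forall>\<Delta> \<in> Con C. \<forall>\<sigma> \<in> Sub C \<Gamma> \<Delta>.
       ty_app D (mCon F \<Gamma>) (mTy F \<Gamma> (K C \<Gamma> \<Delta>)) (K D (mCon F \<Gamma>) (mCon F \<Delta>))
         (F_K \<Gamma> \<Delta>) (mTm F \<Gamma> (K C \<Gamma> \<Delta>) (lamK C \<Gamma> \<Delta> \<sigma>))
       = lamK D (mCon F \<Gamma>) (mCon F \<Delta>) (mSub F \<Gamma> \<Delta> \<sigma>)) \<and>
    (\<forall>\<Gamma> \<in> Con C. \<forall>\<Delta> \<in> Con C. \<forall>t \<in> Tm C \<Gamma> (K C \<Gamma> \<Delta>).
       mSub F \<Gamma> \<Delta> (appK C \<Gamma> \<Delta> t)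
       = appK D (mCon F \<Gamma>) (mCon F \<Delta>)
           (ty_app D (mCon F \<Gamma>) (mTy F \<Gamma> (K C \<Gamma> \<Delta>)) (K D (mCon F \<Gamma>) (mCon F \<Delta>))
              (F_K \<Gamma> \<Delta>) (mTm F \<Gamma> (K C \<Gamma> \<Delta>) t)))"
proof -
  interpret weak_flcwf_morphism C D F
    by fact
  show ?thesis
    apply (rule exI[of _ F_Sig], rule exI[of _ F_K], rule exI[of _ F_Id])
    apply (intro conjI ballI)
    subgoal by (rule F_Sig_iso)
    subgoal by (rule F_K_iso)
    subgoal by (rule F_Id_iso)
    subgoal by (simp only: F_Sig_reindex C.lift_ty_def)
    subgoal by (simp only: F_K_reindex)
    subgoal by (simp only: F_Id_reindex)
    \<comment> \<open>\<open>F_Sig\<close> acts on \<open>F\<close> of a pair as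
      \<open>map_Sig\<close>, whose projections in \<open>C\<close> cancel against that
      pair.\<close>
    subgoal by (simp only: F_Sig_app C.spair_closed map_Sig_id C.proj1_beta C.proj2_beta)
    subgoal by (simp only: F_Sig_app map_Sig_beta)
    subgoal by (simp only: F_Sig_app map_Sig_beta)
    subgoal by (rule F_Id_rfl)
    subgoal by (simp only: F_K_app C.lamK_closed map_K_def C.appK_lamK)
    subgoal by (simp only: F_K_app map_K_def D.appK_lamK mCon_closed mSub_closed C.appK_closed)
    done
qed

end
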